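(* There exists an absolute constant $C>0$ such that for every positive integer $n$, every $n$-vertex topological graph without a self-crossing four-cycle has at most $Cn^{3/2}$ edges.
   Context: A topological graph is a representation of a (finite, simple) graph in the plane such that the vertices of the graph are distinct points of the plane and the edges correspond to Jordan arcs joining the corresponding pairs of points. It is assumed that no edge passes through a vertex other than its endpoints, and that every two edges have a finite number of common interior points and properly cross at each of these points. A self-crossing four-cycle in a topological graph is a cycle of length four in the underlying graph such that some two of its edges cross (i.e. have a common interior point) in the given representation. *)

theory Defs
  imports "HOL-Analysis.Analysis"
begin

text \<open>The plane is the type \<^typ>\<open>complex\<close>; a Jordan arc is a path satisfying \<^const>\<open>arc\<close>.\<close>

definition arc_interior :: "(real \<Rightarrow> complex) \<Rightarrow> complex set" where
  "arc_interior g = path_image g - {pathstart g, pathfinish g}"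

text \<open>
  Proper crossing at \<open>p\<close>: up to a homeomorphism of a neighbourhood of \<open>p\<close> onto the open unit disk
  that sends \<open>p\<close> to the centre, the two arcs are the horizontal and the vertical diameter. In
  particular each arc passes from one side of the other to the opposite side, so touchings are
  excluded.
\<close>

definition properly_cross_at ::
    "(real \<Rightarrow> complex) \<Rightarrow> (real \<Rightarrow> complex) \<Rightarrow> complex \<Rightarrow> bool" where
  "properly_cross_at g g' p \<longleftrightarrow>
     (\<exists>U h k. open U \<and> p \<in> U \<and> homeomorphism U (ball 0 1) h k \<and> h p = 0 \<and>
        h ` (path_image g \<inter> U) = {z \<in> ball 0 1. Im z = 0} \<and>
        h ` (path_image g' \<inter> U) = {z \<in> ball 0 1. Re z = 0})"

definition simple_graph :: "'a set \<Rightarrow> 'a set set \<Rightarrow> bool" where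
  "simple_graph V E \<longleftrightarrow> finite V \<and> (\<forall>e\<in>E. e \<subseteq> V \<and> card e = 2)"

text \<open>
  \<open>\<gamma> e\<close> is the arc representing the edge \<open>e\<close>; values of \<open>\<gamma>\<close> outside \<open>E\<close> are irrelevant, as is the
  direction in which \<open>\<gamma> e\<close> is traversed.
\<close>

definition topological_graph ::
    "complex set \<Rightarrow> complex set set \<Rightarrow> (complex set \<Rightarrow> real \<Rightarrow> complex) \<Rightarrow> bool" where
  "topological_graph V E \<gamma> \<longleftrightarrow>
     simple_graph V E \<and>
     (\<forall>e\<in>E. arc (\<gamma> e) \<and> {pathstart (\<gamma> e), pathfinish (\<gamma> e)} = e \<and>
        arc_interior (\<gamma> e) \<inter> V = {}) \<and>
     (\<forall>e\<in>E. \<forall>f\<in>E. e \<noteq> f \<longrightarrow>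
        finite (arc_interior (\<gamma> e) \<inter> arc_interior (\<gamma> f)) \<and>
        (\<forall>p \<in> arc_interior (\<gamma> e) \<inter> arc_interior (\<gamma> f). properly_cross_at (\<gamma> e) (\<gamma> f) p))"

definition four_cycle :: "'a set set \<Rightarrow> 'a set set \<Rightarrow> bool" where
  "four_cycle E F \<longleftrightarrow>
     (\<exists>a b c d. distinct [a, b, c, d] \<and> F = {{a, b}, {b, c}, {c, d}, {d, a}} \<and> F \<subseteq> E)"

text \<open>The two crossing edges of the cycle may share an endpoint.\<close>

definition self_crossing_four_cycle ::
    "complex set set \<Rightarrow> (complex set \<Rightarrow> real \<Rightarrow> complex) \<Rightarrow> complex set set \<Rightarrow> bool" where
  "self_crossing_four_cycle E \<gamma> F \<longleftrightarrow>
     four_cycle E F \<and>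
     (\<exists>e\<in>F. \<exists>f\<in>F. e \<noteq> f \<and> arc_interior (\<gamma> e) \<inter> arc_interior (\<gamma> f) \<noteq> {})"

end

theory Submission
  imports Defs "HOL-Complex_Analysis.Winding_Numbers"
begin

text \<open>
  Two things make the theorem true: a topological fact, which turns the drawing into linear orders on
  the neighbourhoods of the vertices, and a counting argument for such orders.

  \<^emph>\<open>Topology.\<close> If \<open>u \<noteq> v\<close> have common neighbours \<open>a\<close>, \<open>b\<close>, \<open>c\<close>, any two of the six edges between
  \<open>{u, v}\<close> and \<open>{a, b, c}\<close> lie on a common four-cycle, so without self-crossing four-cycles the drawing
  of this \<open>K\<^bsub>2,3\<^esub>\<close> is plane. Then the edges to \<open>a\<close>, \<open>b\<close>, \<open>c\<close> leave \<open>u\<close> and \<open>v\<close> in opposite cyclic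
  orders. To read off these orders, follow each edge from \<open>u\<close> until it first hits a small circle round
  \<open>u\<close> and sort the neighbours of \<open>u\<close> by the argument of the hitting point. Opposite cyclic orders cannot
  both list \<open>a\<close>, \<open>b\<close>, \<open>c\<close> in this linear order, so no three vertices occur in the same order in the
  lists of two different vertices (\<open>rotations_have_no_common_triple\<close>).
  The reversal (\<open>opposite_rotation\<close>) is proved with winding numbers. Let \<open>J\<close> be the Jordan curve
  \<open>u a v b\<close>. Near each of the corners \<open>u\<close> and \<open>v\<close> the winding number of \<open>J\<close> on the left of \<open>J\<close> exceeds
  that on the right by one (\<open>corner_winding\<close>). As \<open>J\<close> has only two winding numbers, the value on the left
  is the same at both corners. The path \<open>u c v\<close> avoids \<open>J\<close> in between, so it leaves \<open>u\<close> and reaches \<open>v\<close>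
  on the same side of \<open>J\<close>.

  \<^emph>\<open>Counting.\<close> Suppose first that all degrees are about \<open>d\<close>, and put \<open>K = d\<^sup>2 / n\<close>, the average number of
  common neighbours. Cut each list into a first half \<open>P\<^sub>i\<close> and a second half \<open>Q\<^sub>i\<close>. A pair \<open>(a, b)\<close> lies in
  \<open>P\<^sub>i \<times> Q\<^sub>i\<close> for about \<open>K / 4\<close> indices \<open>i\<close>, so by Cauchy-Schwarz the sum of
  \<open>\<bar>P\<^sub>i \<inter> P\<^sub>j\<bar> \<bar>Q\<^sub>i \<inter> Q\<^sub>j\<bar>\<close> over \<open>i\<close>, \<open>j\<close> is at least of order \<open>n\<^sup>2 K\<^sup>2\<close>. In a term that is not zero,
  no two elements of \<open>P\<^sub>i \<inter> P\<^sub>j\<close> can be in the same order in both lists, since together with an element of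
  \<open>Q\<^sub>i \<inter> Q\<^sub>j\<close> they would form a forbidden triple; likewise for \<open>Q\<^sub>i \<inter> Q\<^sub>j\<close>. But reversals are rare.
  For fixed \<open>a\<close>, \<open>b\<close> the pairs \<open>(i, j)\<close> that agree on the order of \<open>a\<close> and \<open>b\<close> are at least as many as
  those that disagree (the square of a sum of signs is nonnegative), while two lists without a forbidden
  triple and with \<open>m\<close> common elements have at most about \<open>m / 2\<close> more agreements than disagreements.
  So the completely reversed intersections satisfy \<open>\<Sum> \<bar>P\<^sub>i \<inter> P\<^sub>j\<bar>\<^sup>2 = O(n\<^sup>2 K)\<close>
  (\<open>reversed_pairs_weight_le\<close>), and \<open>K\<close> is bounded.
  Weighting each vertex by the inverse of its degree replaces the assumption of equal degrees by a lower
  bound on the degrees (\<open>min_degree_bound\<close>), and vertices of low degree can be deleted one by one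
  (\<open>edges_le_of_no_common_triple\<close>).
\<close>

section \<open>Families of linear orders without a common triple\<close>

text \<open>Order \<open>i\<close> lists the set \<open>N i\<close> by increasing values of \<open>f i\<close>. Ties are excluded only between elements
  that two members of the family share, because only shared pairs are compared.\<close>
definition no_common_triple :: "'i set \<Rightarrow> ('i \<Rightarrow> 'a set) \<Rightarrow> ('i \<Rightarrow> 'a \<Rightarrow> real) \<Rightarrow> bool" where
  "no_common_triple X N f \<longleftrightarrow>
     (\<forall>i\<in>X. \<forall>j\<in>X. i \<noteq> j \<longrightarrow> inj_on (f i) (N i \<inter> N j) \<and>
        (\<forall>a\<in>N i \<inter> N j. \<forall>b\<in>N i \<inter> N j. \<forall>c\<in>N i \<inter> N j.
            \<not> (f i a < f i b \<and> f i b < f i c \<and> f j a < f j b \<and> f j b < f j c)))"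

text \<open>The weights are bounded by \<open>M\<close>, so a longest initial part of weight at most one half misses one half by
  at most \<open>M\<close>.\<close>
lemma balanced_cut:
  fixes g :: "'a \<Rightarrow> real" and u :: "'a \<Rightarrow> real"
  assumes "finite A" and pos: "\<And>a. a \<in> A \<Longrightarrow> 0 < u a" and le: "\<And>a. a \<in> A \<Longrightarrow> u a \<le> M" and "A \<noteq> {}"
  shows "\<exists>P. P \<subseteq> A \<and> (\<forall>a\<in>P. \<forall>b\<in>A - P. g a \<le> g b) \<and>
    sum u P \<ge> sum u A / 2 - M \<and> sum u (A - P) \<ge> sum u A / 2"
proof -
  define cuts where "cuts = {P. P \<subseteq> A \<and> (\<forall>a\<in>P. \<forall>b\<in>A - P. g a \<le> g b) \<and> sum u P \<le> sum u A / 2}"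
  have Apos: "sum u A > 0" using assms by (simp add: sum_pos)
  have "cuts \<subseteq> Pow A" by (auto simp: cuts_def)
  then have fin: "finite cuts" using \<open>finite A\<close> finite_subset by blast
  have ne: "cuts \<noteq> {}" using Apos by (auto simp: cuts_def intro!: exI[of _ "{}"])
  have "Max (card ` cuts) \<in> card ` cuts" using fin ne by (intro Max_in) auto
  then obtain P where P: "P \<in> cuts" and "card P = Max (card ` cuts)" by auto
  then have max: "\<And>P'. P' \<in> cuts \<Longrightarrow> card P' \<le> card P" using fin by simp
  have PA: "P \<subseteq> A" and finP: "finite P" using P \<open>finite A\<close> finite_subset by (auto simp: cuts_def)
  have "A - P \<noteq> {}" using P Apos PA by (auto simp: cuts_def)
  moreover have "finite (g ` (A - P))" using \<open>finite A\<close> by simp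
  ultimately have "Min (g ` (A - P)) \<in> g ` (A - P)" by (intro Min_in) auto
  then obtain q where q: "q \<in> A - P" and "g q = Min (g ` (A - P))" by auto
  then have qmin: "\<And>b. b \<in> A - P \<Longrightarrow> g q \<le> g b" using \<open>finite A\<close> by simp
  have "insert q P \<notin> cuts"
    using max[of "insert q P"] q finP by auto
  then have "sum u (insert q P) > sum u A / 2"
    using P q qmin by (auto simp: cuts_def)
  then have "sum u P \<ge> sum u A / 2 - M" using q finP le[of q] by simp
  moreover have "sum u (A - P) \<ge> sum u A / 2"
    using P PA \<open>finite A\<close> by (simp add: cuts_def sum_diff)
  ultimately show ?thesis using P PA by (intro exI[of _ P]) (auto simp: cuts_def)
qed

text \<open>A weighted form of the fact that a triangle-free graph on \<open>m\<close> vertices has at most \<open>m\<^sup>2 / 4\<close> edges.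
  Without a common triple, the elements that follow another one in both orders form an antichain for the
  common order, and so do the remaining ones. With signs \<open>e\<close> that separate these two antichains, the
  product of the two order signs of distinct elements is at most \<open>- e a * e b\<close>, and
  \<open>- (\<Sum>a\<in>R. u a * e a)\<^sup>2 \<le> 0\<close>; only the diagonal remains.\<close>
lemma signed_agreement_le:
  fixes u f g :: "'a \<Rightarrow> real"
  assumes "finite R" and pos: "\<And>a. a \<in> R \<Longrightarrow> 0 \<le> u a"
    and inj: "inj_on f R" "inj_on g R"
    and triple: "\<And>a b c. a \<in> R \<Longrightarrow> b \<in> R \<Longrightarrow> c \<in> R \<Longrightarrow>
        \<not> (f a < f b \<and> f b < f c \<and> g a < g b \<and> g b < g c)"
  shows "(\<Sum>a\<in>R. \<Sum>b\<in>R. u a * u b * (sgn (f a - f b) * sgn (g a - g b))) \<le> (\<Sum>a\<in>R. (u a)\<^sup>2)"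
proof -
  define e :: "'a \<Rightarrow> real" where
    "e b = (if \<exists>a\<in>R. f a < f b \<and> g a < g b then -1 else 1)" for b
  have *: "u a * u b * (sgn (f a - f b) * sgn (g a - g b)) \<le> (if a = b then (u a)\<^sup>2 else 0) - (u a * e a) * (u b * e b)"
    if "a \<in> R" "b \<in> R" for a b
  proof (cases "a = b")
    case True
    then show ?thesis by (auto simp: e_def power2_eq_square)
  next
    case False
    then have ne: "f a \<noteq> f b" "g a \<noteq> g b" using that inj by (auto simp: inj_on_def)
    have "sgn (f a - f b) * sgn (g a - g b) \<le> - (e a * e b)"
    proof (cases "(f a < f b) = (g a < g b)")
      case inc: True
      have "e a * e b = -1"
      proof (cases "f a < f b")
        case True
        then have "e b = -1" using inc that by (auto simp: e_def)
        moreover have "\<not> (\<exists>c\<in>R. f c < f a \<and> g c < g a)" using True inc that triple by blast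
        then have "e a = 1" by (simp add: e_def)
        ultimately show ?thesis by simp
      next
        case False
        then have lt: "f b < f a" "g b < g a" using ne inc by auto
        then have "e a = -1" using that by (auto simp: e_def)
        moreover have "\<not> (\<exists>c\<in>R. f c < f b \<and> g c < g b)" using lt that triple by blast
        then have "e b = 1" by (simp add: e_def)
        ultimately show ?thesis by simp
      qed
      then show ?thesis by (auto simp: sgn_if)
    next
      case dec: False
      then have "sgn (f a - f b) * sgn (g a - g b) = -1" using ne by (auto simp: sgn_if)
      then show ?thesis by (auto simp: e_def)
    qed
    then have "u a * u b * (sgn (f a - f b) * sgn (g a - g b)) \<le> u a * u b * (- (e a * e b))"
      using that pos by (intro mult_left_mono) auto
    then show ?thesis using False by (simp add: algebra_simps)
  qed
  have "(\<Sum>a\<in>R. \<Sum>b\<in>R. u a * u b * (sgn (f a - f b) * sgn (g a - g b)))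
      \<le> (\<Sum>a\<in>R. \<Sum>b\<in>R. (if a = b then (u a)\<^sup>2 else 0) - (u a * e a) * (u b * e b))"
    by (intro sum_mono *)
  also have "\<dots> = (\<Sum>a\<in>R. (u a)\<^sup>2) - (\<Sum>a\<in>R. u a * e a)\<^sup>2"
    using \<open>finite R\<close> by (simp add: sum_subtractf sum.delta' power2_eq_square sum_product)
  finally show ?thesis by (smt (verit) zero_le_power2)
qed

lemma signed_agreement_reversed:
  fixes u f g :: "'a \<Rightarrow> real"
  assumes "finite R" 
    and inj: "inj_on f R" "inj_on g R"
    and rev: "\<And>a b. a \<in> R \<Longrightarrow> b \<in> R \<Longrightarrow> \<not> (f a < f b \<and> g a < g b)"
  shows "(\<Sum>a\<in>R. \<Sum>b\<in>R. u a * u b * (sgn (f a - f b) * sgn (g a - g b))) = (\<Sum>a\<in>R. (u a)\<^sup>2) - (sum u R)\<^sup>2"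
proof -
  have "u a * u b * (sgn (f a - f b) * sgn (g a - g b)) = (if a = b then (u a)\<^sup>2 else 0) - u a * u b"
    if "a \<in> R" "b \<in> R" for a b
  proof (cases "a = b")
    case False
    then have ne: "f a \<noteq> f b" "g a \<noteq> g b" using that inj by (auto simp: inj_on_def)
    then have "sgn (f a - f b) * sgn (g a - g b) = -1"
      using rev[OF that] rev[OF that(2,1)] by (auto simp: sgn_if)
    then show ?thesis using False by simp
  qed (auto simp: power2_eq_square)
  then have "(\<Sum>a\<in>R. \<Sum>b\<in>R. u a * u b * (sgn (f a - f b) * sgn (g a - g b)))
     = (\<Sum>a\<in>R. \<Sum>b\<in>R. (if a = b then (u a)\<^sup>2 else 0) - u a * u b)" by (intro sum.cong refl) auto
  also have "\<dots> = (\<Sum>a\<in>R. (u a)\<^sup>2) - (sum u R)\<^sup>2"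
    using \<open>finite R\<close> by (simp add: sum_subtractf sum.delta' power2_eq_square sum_product)
  finally show ?thesis .
qed

lemma sum_weighted_square:
  fixes h :: "'i \<Rightarrow> 'b \<Rightarrow> real"
  shows "(\<Sum>x\<in>B. v x * (\<Sum>i\<in>X. h i x)\<^sup>2) = (\<Sum>i\<in>X. \<Sum>j\<in>X. \<Sum>x\<in>B. v x * (h i x * h j x))"
proof -
  have "(\<Sum>x\<in>B. v x * (\<Sum>i\<in>X. h i x)\<^sup>2) = (\<Sum>x\<in>B. \<Sum>i\<in>X. \<Sum>j\<in>X. v x * (h i x * h j x))"
    unfolding power2_eq_square sum_product by (simp only: sum_distrib_left)
  also have "\<dots> = (\<Sum>i\<in>X. \<Sum>x\<in>B. \<Sum>j\<in>X. v x * (h i x * h j x))" by (rule sum.swap)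
  also have "\<dots> = (\<Sum>i\<in>X. \<Sum>j\<in>X. \<Sum>x\<in>B. v x * (h i x * h j x))" by (intro sum.cong refl sum.swap)
  finally show ?thesis .
qed

lemma sum_over_common_elements:
  assumes "finite X" "finite Y" "\<And>i. i \<in> X \<Longrightarrow> N i \<subseteq> Y"
  shows "(\<Sum>i\<in>X. \<Sum>j\<in>X. \<Sum>a\<in>N i \<inter> N j. h a) = (\<Sum>a\<in>Y. (real (card {i\<in>X. a \<in> N i}))\<^sup>2 * h a)"
proof -
  have "(\<Sum>a\<in>Y. h a * (\<Sum>i\<in>X. if a \<in> N i then 1 else 0)\<^sup>2)
     = (\<Sum>i\<in>X. \<Sum>j\<in>X. \<Sum>a\<in>Y. h a * ((if a \<in> N i then 1 else 0) * (if a \<in> N j then 1 else (0::real))))"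
    by (rule sum_weighted_square)
  also have "\<dots> = (\<Sum>i\<in>X. \<Sum>j\<in>X. \<Sum>a\<in>N i \<inter> N j. h a)"
  proof (rule sum.cong[OF refl], rule sum.cong[OF refl])
    fix i j assume "i \<in> X" "j \<in> X"
    show "(\<Sum>a\<in>Y. h a * ((if a \<in> N i then 1 else 0) * (if a \<in> N j then 1 else (0::real)))) = (\<Sum>a\<in>N i \<inter> N j. h a)"
      using assms \<open>i \<in> X\<close> by (intro sum.mono_neutral_cong_right) auto
  qed
  finally show ?thesis using assms(1) by (simp add: sum.If_cases Int_def mult.commute)
qed

text \<open>For each pair \<open>(a, b)\<close> let \<open>h i (a, b)\<close> be the sign of its order in the list \<open>i\<close>, and \<open>0\<close> if it is not
  listed. The weighted sum of \<open>(\<Sum>i. h i (a, b))\<^sup>2\<close> is nonnegative, and expanding the squares gives the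
  signed agreements of all pairs of lists. Those of the reversed pairs in \<open>G\<close> are very negative, all others
  contribute at most a diagonal term.\<close>
lemma reversed_pairs_weight_le:
  fixes f :: "'i \<Rightarrow> 'a \<Rightarrow> real"
  assumes fin: "finite X" "finite Y" and sub: "\<And>i. i \<in> X \<Longrightarrow> R i \<subseteq> Y"
    and pos: "\<And>a. a \<in> Y \<Longrightarrow> 0 \<le> u a"
    and nt: "no_common_triple X R f"
    and G: "G \<subseteq> {(i, j). i \<in> X \<and> j \<in> X \<and> i \<noteq> j}"
    and rev: "\<And>i j a b. (i, j) \<in> G \<Longrightarrow> a \<in> R i \<inter> R j \<Longrightarrow> b \<in> R i \<inter> R j \<Longrightarrow> \<not> (f i a < f i b \<and> f j a < f j b)"
  shows "(\<Sum>(i, j)\<in>G. (sum u (R i \<inter> R j))\<^sup>2)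
     \<le> (\<Sum>i\<in>X. (sum u (R i))\<^sup>2) + (\<Sum>a\<in>Y. (real (card {i\<in>X. a \<in> R i}))\<^sup>2 * (u a)\<^sup>2)"
proof -
  define S where "S i j = (\<Sum>a\<in>R i \<inter> R j. \<Sum>b\<in>R i \<inter> R j. u a * u b * (sgn (f i a - f i b) * sgn (f j a - f j b)))" for i j
  define h where "h i = (\<lambda>(a, b). if a \<in> R i \<and> b \<in> R i then sgn (f i a - f i b) else 0)" for i
  have finR: "finite (R i)" if "i \<in> X" for i using that sub fin finite_subset by blast
  have "0 \<le> (\<Sum>x\<in>Y\<times>Y. (u (fst x) * u (snd x)) * (\<Sum>i\<in>X. h i x)\<^sup>2)"
    using pos by (intro sum_nonneg mult_nonneg_nonneg) auto
  also have "\<dots> = (\<Sum>i\<in>X. \<Sum>j\<in>X. \<Sum>x\<in>Y\<times>Y. (u (fst x) * u (snd x)) * (h i x * h j x))"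
    by (rule sum_weighted_square)
  also have "\<dots> = (\<Sum>i\<in>X. \<Sum>j\<in>X. S i j)"
  proof (intro sum.cong refl)
    fix i j assume "i \<in> X" "j \<in> X"
    have "(\<Sum>x\<in>Y\<times>Y. (u (fst x) * u (snd x)) * (h i x * h j x))
        = (\<Sum>x\<in>(R i \<inter> R j)\<times>(R i \<inter> R j). (u (fst x) * u (snd x)) * (h i x * h j x))"
      using sub[OF \<open>i \<in> X\<close>] fin by (intro sum.mono_neutral_right) (auto simp: h_def split: if_splits)
    also have "\<dots> = S i j"
      unfolding S_def sum.cartesian_product by (intro sum.cong) (auto simp: h_def)
    finally show "(\<Sum>x\<in>Y\<times>Y. (u (fst x) * u (snd x)) * (h i x * h j x)) = S i j" .
  qed
  also have "\<dots> \<le> (\<Sum>i\<in>X. \<Sum>j\<in>X. (if i = j then (sum u (R i))\<^sup>2 else 0) + (\<Sum>a\<in>R i \<inter> R j. (u a)\<^sup>2)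
                     - (if (i, j) \<in> G then (sum u (R i \<inter> R j))\<^sup>2 else 0))"
  proof (rule sum_mono, rule sum_mono)
    fix i j assume ij: "i \<in> X" "j \<in> X"
    have posR: "\<And>a. a \<in> R i \<inter> R j \<Longrightarrow> 0 \<le> u a" using sub pos ij by blast
    show "S i j \<le> (if i = j then (sum u (R i))\<^sup>2 else 0) + (\<Sum>a\<in>R i \<inter> R j. (u a)\<^sup>2)
                     - (if (i, j) \<in> G then (sum u (R i \<inter> R j))\<^sup>2 else 0)"
    proof (cases "i = j")
      case True
      have "S i i \<le> (\<Sum>a\<in>R i. \<Sum>b\<in>R i. u a * u b)"
        unfolding S_def Int_absorb
      proof (rule sum_mono, rule sum_mono)
        fix a b assume "a \<in> R i" "b \<in> R i"
        then show "u a * u b * (sgn (f i a - f i b) * sgn (f i a - f i b)) \<le> u a * u b"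
          using posR True by (intro mult_left_le) (auto simp: sgn_if)
      qed
      also have "\<dots> = (sum u (R i))\<^sup>2" by (simp add: power2_eq_square sum_product)
      finally have "S i i \<le> (sum u (R i))\<^sup>2" .
      moreover have "0 \<le> (\<Sum>a\<in>R i. (u a)\<^sup>2)" by (simp add: sum_nonneg)
      moreover have "(i, j) \<notin> G" using G True by auto
      ultimately show ?thesis using True by simp
    next
      case False
      note nt' = nt[unfolded no_common_triple_def, THEN bspec, THEN bspec, THEN mp]
      have inj: "inj_on (f i) (R i \<inter> R j)" "inj_on (f j) (R i \<inter> R j)"
        using nt'[OF ij False] nt'[OF ij(2,1) False[symmetric]] by (simp_all only: Int_commute)
      have triple: "\<forall>a\<in>R i \<inter> R j. \<forall>b\<in>R i \<inter> R j. \<forall>c\<in>R i \<inter> R j.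
            \<not> (f i a < f i b \<and> f i b < f i c \<and> f j a < f j b \<and> f j b < f j c)"
        using nt'[OF ij False] by (rule conjunct2)
      have fin': "finite (R i \<inter> R j)" using finR ij by auto
      show ?thesis
      proof (cases "(i, j) \<in> G")
        case True
        show ?thesis
          using signed_agreement_reversed[OF fin' inj rev[OF True], of u] True False by (simp add: S_def)
      next
        case nG: False
        have "\<And>a b c. a \<in> R i \<inter> R j \<Longrightarrow> b \<in> R i \<inter> R j \<Longrightarrow> c \<in> R i \<inter> R j \<Longrightarrow>
           \<not> (f i a < f i b \<and> f i b < f i c \<and> f j a < f j b \<and> f j b < f j c)"
          using triple by meson
        from signed_agreement_le[OF fin' posR inj this]
        show ?thesis using nG False by (simp add: S_def)
      qed
    qed
  qed
  also have "\<dots> = (\<Sum>i\<in>X. (sum u (R i))\<^sup>2) + (\<Sum>i\<in>X. \<Sum>j\<in>X. \<Sum>a\<in>R i \<inter> R j. (u a)\<^sup>2)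
      - (\<Sum>i\<in>X. \<Sum>j\<in>X. if (i, j) \<in> G then (sum u (R i \<inter> R j))\<^sup>2 else 0)"
    using fin by (simp add: sum_subtractf sum.distrib)
  also have "(\<Sum>i\<in>X. \<Sum>j\<in>X. if (i, j) \<in> G then (sum u (R i \<inter> R j))\<^sup>2 else 0) = (\<Sum>(i, j)\<in>G. (sum u (R i \<inter> R j))\<^sup>2)"
    unfolding sum.cartesian_product
    using G fin by (intro sum.mono_neutral_cong_right) auto
  also have "(\<Sum>i\<in>X. \<Sum>j\<in>X. \<Sum>a\<in>R i \<inter> R j. (u a)\<^sup>2) = (\<Sum>a\<in>Y. (real (card {i\<in>X. a \<in> R i}))\<^sup>2 * (u a)\<^sup>2)"
    by (rule sum_over_common_elements[OF fin sub])
  finally show ?thesis by linarith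
qed

lemma no_common_triple_mono:
  assumes "no_common_triple X N f" "X' \<subseteq> X" "\<And>i. i \<in> X' \<Longrightarrow> R i \<subseteq> N i"
  shows "no_common_triple X' R f"
  unfolding no_common_triple_def
proof (intro ballI impI conjI)
  note nt' = assms(1)[unfolded no_common_triple_def, THEN bspec, THEN bspec, THEN mp]
  fix i j assume ij: "i \<in> X'" "j \<in> X'" "i \<noteq> j"
  then have ij': "i \<in> X" "j \<in> X" using assms(2) by auto
  have sub: "R i \<inter> R j \<subseteq> N i \<inter> N j" using ij assms(3) by blast
  show "inj_on (f i) (R i \<inter> R j)"
    using nt'[OF ij' ij(3)] sub by (blast intro: inj_on_subset)
  fix a b c assume abc: "a \<in> R i \<inter> R j" "b \<in> R i \<inter> R j" "c \<in> R i \<inter> R j"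
  have "\<forall>a\<in>N i \<inter> N j. \<forall>b\<in>N i \<inter> N j. \<forall>c\<in>N i \<inter> N j.
            \<not> (f i a < f i b \<and> f i b < f i c \<and> f j a < f j b \<and> f j b < f j c)"
    using nt'[OF ij' ij(3)] by (rule conjunct2)
  then show "\<not> (f i a < f i b \<and> f i b < f i c \<and> f j a < f j b \<and> f j b < f j c)"
    using abc sub by (meson subsetD)
qed

text \<open>A common element of both upper parts completes any agreement inside the common lower part to a common
  triple, and vice versa.\<close>
lemma cuts_reverse:
  fixes f :: "'i \<Rightarrow> 'a \<Rightarrow> real"
  assumes nt: "no_common_triple X N f" and ij: "i \<in> X" "j \<in> X" "i \<noteq> j"
    and N: "\<And>k. k \<in> X \<Longrightarrow> P k \<union> Q k = N k" "\<And>k. k \<in> X \<Longrightarrow> P k \<inter> Q k = {}"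
    and cut: "\<And>k a b. k \<in> X \<Longrightarrow> a \<in> P k \<Longrightarrow> b \<in> Q k \<Longrightarrow> f k a \<le> f k b"
    and ne: "P i \<inter> P j \<noteq> {}" "Q i \<inter> Q j \<noteq> {}"
  shows "\<And>a b. a \<in> P i \<inter> P j \<Longrightarrow> b \<in> P i \<inter> P j \<Longrightarrow> \<not> (f i a < f i b \<and> f j a < f j b)"
    and "\<And>a b. a \<in> Q i \<inter> Q j \<Longrightarrow> b \<in> Q i \<inter> Q j \<Longrightarrow> \<not> (f i a < f i b \<and> f j a < f j b)"
proof -
  note nt' = nt[unfolded no_common_triple_def, THEN bspec, THEN bspec, THEN mp]
  have inj: "inj_on (f i) (N i \<inter> N j)" "inj_on (f j) (N i \<inter> N j)"
    using nt'[OF ij] nt'[OF ij(2,1) ij(3)[symmetric]] by (simp_all only: Int_commute)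
  have triple: "\<And>a b c. a \<in> N i \<inter> N j \<Longrightarrow> b \<in> N i \<inter> N j \<Longrightarrow> c \<in> N i \<inter> N j \<Longrightarrow>
            \<not> (f i a < f i b \<and> f i b < f i c \<and> f j a < f j b \<and> f j b < f j c)"
    using nt'[OF ij, THEN conjunct2] by meson
  have strict: "f i p < f i q \<and> f j p < f j q" if "p \<in> P i \<inter> P j" "q \<in> Q i \<inter> Q j" for p q
  proof -
    have "p \<in> N i \<inter> N j" "q \<in> N i \<inter> N j" "p \<noteq> q" using that N ij by auto
    then have "f i p \<noteq> f i q" "f j p \<noteq> f j q" using inj by (auto dest: inj_onD)
    moreover have "f i p \<le> f i q" "f j p \<le> f j q" using that cut ij by auto
    ultimately show ?thesis by simp
  qed
  have PN: "P i \<inter> P j \<subseteq> N i \<inter> N j" and QN: "Q i \<inter> Q j \<subseteq> N i \<inter> N j" using N ij by auto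
  show "\<not> (f i a < f i b \<and> f j a < f j b)" if ab: "a \<in> P i \<inter> P j" "b \<in> P i \<inter> P j" for a b
  proof -
    obtain c where c: "c \<in> Q i \<inter> Q j" using ne by blast
    show ?thesis using triple[of a b c] strict[OF ab(2) c] ab c PN QN by blast
  qed
  show "\<not> (f i a < f i b \<and> f j a < f j b)" if ab: "a \<in> Q i \<inter> Q j" "b \<in> Q i \<inter> Q j" for a b
  proof -
    obtain c where c: "c \<in> P i \<inter> P j" using ne by blast
    show ?thesis using triple[of c a b] strict[OF c ab(1)] ab c PN QN by blast
  qed
qed

text \<open>The weights \<open>u a = 1 / deg a\<close> make the two error terms harmless: the diagonal terms
  \<open>\<Sum>a. (deg a)\<^sup>2 * (u a)\<^sup>2\<close> add up to \<open>n\<close>, and a lower bound on the degrees bounds \<open>\<Sum>a. u a\<close>.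
  With \<open>U i\<close> the weight of list \<open>i\<close> and \<open>W = \<Sum>i. (U i)\<^sup>2 \<ge> n\<close>, the Cauchy-Schwarz inequality for the cut
  lists gives \<open>(W / 8)\<^sup>2 \<le> (n / \<delta>)\<^sup>2 * 2 * W\<close>.\<close>
lemma min_degree_bound:
  fixes f :: "'i \<Rightarrow> 'a \<Rightarrow> real"
  assumes fin: "finite X" "finite Y" and sub: "\<And>i. i \<in> X \<Longrightarrow> N i \<subseteq> Y"
    and nt: "no_common_triple X N f"
    and n: "card X = n" "card Y = n" "n > 0"
    and d0: "\<delta> > 0"
    and degN: "\<And>i. i \<in> X \<Longrightarrow> \<delta> \<le> real (card (N i))"
    and degY: "\<And>a. a \<in> Y \<Longrightarrow> \<delta> \<le> real (card {i\<in>X. a \<in> N i})"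
  shows "\<delta>\<^sup>2 \<le> 128 * real n"
proof (rule ccontr)
  assume "\<not> \<delta>\<^sup>2 \<le> 128 * real n"
  then have big: "\<delta>\<^sup>2 > 128 * real n" by simp
  \<comment> \<open>If the claim fails, every list weighs at least four times the largest weight, so it can be cut.\<close>
  define dg where "dg a = real (card {i\<in>X. a \<in> N i})" for a
  define u where "u a = 1 / dg a" for a
  have dg: "\<delta> \<le> dg a" "dg a \<le> n" if "a \<in> Y" for a
    using degY[OF that] card_mono[OF fin(1), of "{i\<in>X. a \<in> N i}"] n by (auto simp: dg_def)
  have upos: "0 < u a" and u_le: "u a \<le> 1 / \<delta>" and u_ge: "u a \<ge> 1 / n" if "a \<in> Y" for a
    using dg[OF that] d0 by (auto simp: u_def intro!: divide_left_mono mult_pos_pos)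
  have finN: "finite (N i)" if "i \<in> X" for i using that sub fin finite_subset by blast
  have Ulow: "sum u (N i) \<ge> 4 / \<delta>" if "i \<in> X" for i
  proof -
    have "4 / \<delta> \<le> \<delta> * (1 / n)"
      using big d0 n by (simp add: field_simps power2_eq_square)
    also have "\<dots> \<le> card (N i) * (1 / n)"
      using degN[OF that] by (intro mult_right_mono) auto
    also have "\<dots> \<le> sum u (N i)"
      using u_ge sub[OF that] by (intro sum_bounded_below) auto
    finally show ?thesis .
  qed
  have "\<forall>i\<in>X. \<exists>P. P \<subseteq> N i \<and> (\<forall>a\<in>P. \<forall>b\<in>N i - P. f i a \<le> f i b) \<and>
      sum u P \<ge> sum u (N i) / 2 - 1 / \<delta> \<and> sum u (N i - P) \<ge> sum u (N i) / 2"
  proof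
    fix i assume i: "i \<in> X"
    have "N i \<noteq> {}" using Ulow[OF i] d0 by (auto simp: field_simps)
    moreover have "\<And>a. a \<in> N i \<Longrightarrow> 0 < u a" "\<And>a. a \<in> N i \<Longrightarrow> u a \<le> 1 / \<delta>"
      using upos u_le sub[OF i] by auto
    ultimately show "\<exists>P. P \<subseteq> N i \<and> (\<forall>a\<in>P. \<forall>b\<in>N i - P. f i a \<le> f i b) \<and>
      sum u P \<ge> sum u (N i) / 2 - 1 / \<delta> \<and> sum u (N i - P) \<ge> sum u (N i) / 2"
      using finN[OF i] by (intro balanced_cut) auto
  qed
  from bchoice[OF this] obtain P where P: "\<forall>i\<in>X. P i \<subseteq> N i \<and> (\<forall>a\<in>P i. \<forall>b\<in>N i - P i. f i a \<le> f i b) \<and>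
      sum u (P i) \<ge> sum u (N i) / 2 - 1 / \<delta> \<and> sum u (N i - P i) \<ge> sum u (N i) / 2" ..
  define Q where "Q i = N i - P i" for i
  have PQ: "\<And>i. i \<in> X \<Longrightarrow> P i \<union> Q i = N i" "\<And>i. i \<in> X \<Longrightarrow> P i \<inter> Q i = {}"
      "\<And>i a b. i \<in> X \<Longrightarrow> a \<in> P i \<Longrightarrow> b \<in> Q i \<Longrightarrow> f i a \<le> f i b"
    and Plow: "\<And>i. i \<in> X \<Longrightarrow> sum u (P i) \<ge> sum u (N i) / 4"
    and Qlow: "\<And>i. i \<in> X \<Longrightarrow> sum u (Q i) \<ge> sum u (N i) / 2"
    using P Ulow by (fastforce simp: Q_def)+
  have PN: "P i \<subseteq> N i" and QN: "Q i \<subseteq> N i" if "i \<in> X" for i using PQ(1)[OF that] by auto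
  have PY: "P i \<subseteq> Y" and QY: "Q i \<subseteq> Y" if "i \<in> X" for i using PN[OF that] QN[OF that] sub[OF that] by auto
  define U where "U i = sum u (N i)" for i
  define W where "W = (\<Sum>i\<in>X. (U i)\<^sup>2)"
  have UPQ: "sum u (P i) + sum u (Q i) = U i" if "i \<in> X" for i
    unfolding U_def PQ(1)[OF that, symmetric] using PQ(2)[OF that] finN[OF that] PN[OF that] QN[OF that]
    by (intro sum.union_disjoint[symmetric]) (auto intro: finite_subset)
  have U0: "U i > 0" if "i \<in> X" for i using Ulow[OF that] d0 by (auto simp: U_def intro: less_le_trans[rotated])

  have "(\<Sum>i\<in>X. U i) = (\<Sum>a\<in>Y. \<Sum>i\<in>{i\<in>X. a \<in> N i}. u a)"
  proof -
    have "(\<Sum>i\<in>X. U i) = (\<Sum>i\<in>X. \<Sum>a\<in>{a\<in>Y. a \<in> N i}. u a)"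
      unfolding U_def using sub by (intro sum.cong refl) blast+
    also have "\<dots> = (\<Sum>a\<in>Y. \<Sum>i\<in>{i\<in>X. a \<in> N i}. u a)"
      by (rule sum.swap_restrict[OF fin])
    finally show ?thesis .
  qed
  also have "\<dots> = (\<Sum>a\<in>Y. 1)"
    using dg d0 by (intro sum.cong refl) (force simp: u_def dg_def)
  finally have Utot: "(\<Sum>i\<in>X. U i) = n" using n by simp
  have "(\<Sum>i\<in>X. U i * 1)\<^sup>2 \<le> (\<Sum>i\<in>X. (U i)\<^sup>2) * (\<Sum>i\<in>X. 1\<^sup>2)"
    by (rule Cauchy_Schwarz_ineq_sum)
  then have "(real n)\<^sup>2 \<le> W * n" using Utot n by (simp add: W_def)
  then have Wn: "real n \<le> W" using n by (simp add: power2_eq_square)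

  define G where "G = {(i, j). i \<in> X \<and> j \<in> X \<and> i \<noteq> j \<and> P i \<inter> P j \<noteq> {} \<and> Q i \<inter> Q j \<noteq> {}}"
  have G: "G \<subseteq> {(i, j). i \<in> X \<and> j \<in> X \<and> i \<noteq> j}" by (auto simp: G_def)
  have revP: "\<not> (f i a < f i b \<and> f j a < f j b)"
    if "(i, j) \<in> G" "a \<in> P i \<inter> P j" "b \<in> P i \<inter> P j" for i j a b
    using that cuts_reverse(1)[OF nt _ _ _ PQ(1,2,3), of i j a b] by (simp add: G_def)
  have revQ: "\<not> (f i a < f i b \<and> f j a < f j b)"
    if "(i, j) \<in> G" "a \<in> Q i \<inter> Q j" "b \<in> Q i \<inter> Q j" for i j a b
    using that cuts_reverse(2)[OF nt _ _ _ PQ(1,2,3), of i j a b] by (simp add: G_def)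
  have diag: "(\<Sum>a\<in>Y. (real (card {i\<in>X. a \<in> R i}))\<^sup>2 * (u a)\<^sup>2) \<le> n" if "\<And>i. i \<in> X \<Longrightarrow> R i \<subseteq> N i" for R
  proof -
    have "(\<Sum>a\<in>Y. (real (card {i\<in>X. a \<in> R i}))\<^sup>2 * (u a)\<^sup>2) \<le> (\<Sum>a\<in>Y. 1)"
    proof (rule sum_mono)
      fix a assume a: "a \<in> Y"
      have "real (card {i\<in>X. a \<in> R i}) \<le> dg a"
        unfolding dg_def of_nat_le_iff using fin that by (intro card_mono) auto
      then have "real (card {i\<in>X. a \<in> R i}) * u a \<le> dg a * u a"
        using upos[OF a] by (intro mult_right_mono) auto
      also have "\<dots> = 1" using dg[OF a] d0 by (simp add: u_def)
      finally have "(real (card {i\<in>X. a \<in> R i}) * u a)\<^sup>2 \<le> 1"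
        using upos[OF a] by (simp add: power_le_one)
      then show "(real (card {i\<in>X. a \<in> R i}))\<^sup>2 * (u a)\<^sup>2 \<le> 1" by (simp add: power_mult_distrib)
    qed
    then show ?thesis using n by simp
  qed
  have bound: "(\<Sum>(i, j)\<in>G. (sum u (R i \<inter> R j))\<^sup>2) \<le> (\<Sum>i\<in>X. (sum u (R i))\<^sup>2) + n"
    if RN: "\<And>i. i \<in> X \<Longrightarrow> R i \<subseteq> N i"
      and rev: "\<And>i j a b. (i, j) \<in> G \<Longrightarrow> a \<in> R i \<inter> R j \<Longrightarrow> b \<in> R i \<inter> R j \<Longrightarrow> \<not> (f i a < f i b \<and> f j a < f j b)"
    for R
  proof -
    have "no_common_triple X R f" by (rule no_common_triple_mono[OF nt order_refl RN])
    moreover have "\<And>i. i \<in> X \<Longrightarrow> R i \<subseteq> Y" using RN sub by blast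
    ultimately have "(\<Sum>(i, j)\<in>G. (sum u (R i \<inter> R j))\<^sup>2)
       \<le> (\<Sum>i\<in>X. (sum u (R i))\<^sup>2) + (\<Sum>a\<in>Y. (real (card {i\<in>X. a \<in> R i}))\<^sup>2 * (u a)\<^sup>2)"
      using reversed_pairs_weight_le[OF fin, of R u f G] less_imp_le[OF upos] G rev by blast
    then show ?thesis using diag[of R] RN by fastforce
  qed
  have boundP: "(\<Sum>(i, j)\<in>G. (sum u (P i \<inter> P j))\<^sup>2) \<le> (\<Sum>i\<in>X. (sum u (P i))\<^sup>2) + n"
    using PN revP by (intro bound)
  have boundQ: "(\<Sum>(i, j)\<in>G. (sum u (Q i \<inter> Q j))\<^sup>2) \<le> (\<Sum>i\<in>X. (sum u (Q i))\<^sup>2) + n"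
    using QN revQ by (intro bound)

  \<comment> \<open>Lower bound: \<open>r (a, b)\<close> counts the lists that have \<open>a\<close> below and \<open>b\<close> above the cut.\<close>
  define r where "r = (\<lambda>(a, b). \<Sum>i\<in>X. if a \<in> P i \<and> b \<in> Q i then 1 else (0::real))"
  define v where "v = (\<lambda>(a, b). u a * u b)"
  have single: "(\<Sum>x\<in>Y\<times>Y. v x * (if fst x \<in> A \<and> snd x \<in> B then 1 else 0)) = sum u A * sum u B"
    if "A \<subseteq> Y" "B \<subseteq> Y" for A B
  proof -
    have "(\<Sum>x\<in>Y\<times>Y. v x * (if fst x \<in> A \<and> snd x \<in> B then 1 else 0)) = (\<Sum>x\<in>A\<times>B. v x)"
      using that fin by (intro sum.mono_neutral_cong_right) auto
    also have "\<dots> = sum u A * sum u B" by (simp add: v_def sum_product sum.cartesian_product)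
    finally show ?thesis .
  qed
  have r': "r x = (\<Sum>i\<in>X. if fst x \<in> P i \<and> snd x \<in> Q i then 1 else (0::real))" for x
    by (simp add: r_def case_prod_unfold)
  have T: "(\<Sum>x\<in>Y\<times>Y. v x * r x) = (\<Sum>i\<in>X. sum u (P i) * sum u (Q i))"
  proof -
    have "(\<Sum>x\<in>Y\<times>Y. v x * r x) = (\<Sum>x\<in>Y\<times>Y. \<Sum>i\<in>X. v x * (if fst x \<in> P i \<and> snd x \<in> Q i then 1 else 0))"
      unfolding r' by (rule sum.cong[OF refl], rule sum_distrib_left)
    also have "\<dots> = (\<Sum>i\<in>X. \<Sum>x\<in>Y\<times>Y. v x * (if fst x \<in> P i \<and> snd x \<in> Q i then 1 else 0))"
      by (rule sum.swap)
    also have "\<dots> = (\<Sum>i\<in>X. sum u (P i) * sum u (Q i))"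
      by (rule sum.cong[OF refl], rule single[OF PY QY])
    finally show ?thesis .
  qed
  have Sig: "(\<Sum>x\<in>Y\<times>Y. v x * (r x)\<^sup>2) = (\<Sum>i\<in>X. \<Sum>j\<in>X. sum u (P i \<inter> P j) * sum u (Q i \<inter> Q j))"
    unfolding r' sum_weighted_square
  proof (rule sum.cong[OF refl], rule sum.cong[OF refl])
    fix i j assume ij: "i \<in> X" "j \<in> X"
    have "(\<Sum>x\<in>Y\<times>Y. v x * ((if fst x \<in> P i \<and> snd x \<in> Q i then 1 else 0) * (if fst x \<in> P j \<and> snd x \<in> Q j then 1 else 0)))
       = (\<Sum>x\<in>Y\<times>Y. v x * (if fst x \<in> P i \<inter> P j \<and> snd x \<in> Q i \<inter> Q j then 1 else 0))"
      by (intro sum.cong refl) auto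
    also have "\<dots> = sum u (P i \<inter> P j) * sum u (Q i \<inter> Q j)"
      using PY QY ij by (intro single) blast+
    finally show "(\<Sum>x\<in>Y\<times>Y. v x * ((if fst x \<in> P i \<and> snd x \<in> Q i then 1 else 0) * (if fst x \<in> P j \<and> snd x \<in> Q j then 1 else 0)))
       = sum u (P i \<inter> P j) * sum u (Q i \<inter> Q j)" .
  qed
  have vnn: "v x \<ge> 0" if "x \<in> Y \<times> Y" for x using that upos by (auto simp: v_def intro!: mult_nonneg_nonneg less_imp_le)
  have "(\<Sum>x\<in>Y\<times>Y. sqrt (v x) * (sqrt (v x) * r x))\<^sup>2 \<le> (\<Sum>x\<in>Y\<times>Y. (sqrt (v x))\<^sup>2) * (\<Sum>x\<in>Y\<times>Y. (sqrt (v x) * r x)\<^sup>2)"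
    by (rule Cauchy_Schwarz_ineq_sum)
  also have "(\<Sum>x\<in>Y\<times>Y. sqrt (v x) * (sqrt (v x) * r x)) = (\<Sum>x\<in>Y\<times>Y. v x * r x)"
    using vnn by (intro sum.cong refl) (simp flip: mult.assoc)
  also have "(\<Sum>x\<in>Y\<times>Y. (sqrt (v x))\<^sup>2) = (\<Sum>x\<in>Y\<times>Y. v x)"
    using vnn by (intro sum.cong refl) simp
  also have "(\<Sum>x\<in>Y\<times>Y. v x) = (sum u Y)\<^sup>2"
    by (simp add: v_def sum_product sum.cartesian_product power2_eq_square)
  also have "(\<Sum>x\<in>Y\<times>Y. (sqrt (v x) * r x)\<^sup>2) = (\<Sum>x\<in>Y\<times>Y. v x * (r x)\<^sup>2)"
    using vnn by (intro sum.cong refl) (simp add: power_mult_distrib)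
  finally have CS: "(\<Sum>i\<in>X. sum u (P i) * sum u (Q i))\<^sup>2
      \<le> (sum u Y)\<^sup>2 * (\<Sum>i\<in>X. \<Sum>j\<in>X. sum u (P i \<inter> P j) * sum u (Q i \<inter> Q j))"
    unfolding T Sig .

  have Tlow: "W / 8 \<le> (\<Sum>i\<in>X. sum u (P i) * sum u (Q i))"
    unfolding W_def sum_divide_distrib
  proof (rule sum_mono)
    fix i assume i: "i \<in> X"
    have "(U i / 4) * (U i / 2) \<le> sum u (P i) * sum u (Q i)"
      using Plow[OF i] Qlow[OF i] U0[OF i] by (intro mult_mono) (auto simp: U_def)
    then show "(U i)\<^sup>2 / 8 \<le> sum u (P i) * sum u (Q i)" by (simp add: power2_eq_square)
  qed
  have uY: "sum u Y \<le> n / \<delta>"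
    using sum_bounded_above[of Y u "1 / \<delta>"] u_le n by simp
  have uY0: "sum u Y \<ge> 0" using upos by (intro sum_nonneg less_imp_le)

  \<comment> \<open>Upper bound: a nonzero product with \<open>i \<noteq> j\<close> belongs to a pair in \<open>G\<close>.\<close>
  have split: "sum u (P i \<inter> P j) * sum u (Q i \<inter> Q j) \<le> (if i = j then sum u (P i) * sum u (Q i) else 0)
      + (if (i, j) \<in> G then ((sum u (P i \<inter> P j))\<^sup>2 + (sum u (Q i \<inter> Q j))\<^sup>2) / 2 else 0)"
    if "i \<in> X" "j \<in> X" for i j
  proof (cases "(i, j) \<in> G")
    case True
    then have "i \<noteq> j" by (auto simp: G_def)
    then show ?thesis using True sum_squares_bound[of "sum u (P i \<inter> P j)" "sum u (Q i \<inter> Q j)"] by simp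
  next
    case False
    then show ?thesis using that by (auto simp: G_def)
  qed
  have Sigma: "(\<Sum>i\<in>X. \<Sum>j\<in>X. sum u (P i \<inter> P j) * sum u (Q i \<inter> Q j)) \<le> 2 * W"
  proof -
    have "(\<Sum>i\<in>X. \<Sum>j\<in>X. sum u (P i \<inter> P j) * sum u (Q i \<inter> Q j))
       \<le> (\<Sum>i\<in>X. \<Sum>j\<in>X. (if i = j then sum u (P i) * sum u (Q i) else 0)
          + (if (i, j) \<in> G then ((sum u (P i \<inter> P j))\<^sup>2 + (sum u (Q i \<inter> Q j))\<^sup>2) / 2 else 0))"
      by (intro sum_mono split)
    also have "\<dots> = (\<Sum>i\<in>X. sum u (P i) * sum u (Q i))
          + (\<Sum>i\<in>X. \<Sum>j\<in>X. if (i, j) \<in> G then ((sum u (P i \<inter> P j))\<^sup>2 + (sum u (Q i \<inter> Q j))\<^sup>2) / 2 else 0)"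
      using fin by (simp add: sum.distrib)
    also have "(\<Sum>i\<in>X. \<Sum>j\<in>X. if (i, j) \<in> G then ((sum u (P i \<inter> P j))\<^sup>2 + (sum u (Q i \<inter> Q j))\<^sup>2) / 2 else 0)
       = (\<Sum>(i, j)\<in>G. ((sum u (P i \<inter> P j))\<^sup>2 + (sum u (Q i \<inter> Q j))\<^sup>2) / 2)"
      unfolding sum.cartesian_product
      using G fin by (intro sum.mono_neutral_cong_right) auto
    also have "\<dots> = ((\<Sum>(i, j)\<in>G. (sum u (P i \<inter> P j))\<^sup>2) + (\<Sum>(i, j)\<in>G. (sum u (Q i \<inter> Q j))\<^sup>2)) / 2"
      by (simp add: case_prod_unfold sum.distrib flip: sum_divide_distrib)
    also have "\<dots> \<le> ((\<Sum>i\<in>X. (sum u (P i))\<^sup>2) + n + ((\<Sum>i\<in>X. (sum u (Q i))\<^sup>2) + n)) / 2"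
      using boundP boundQ by simp
    finally have "(\<Sum>i\<in>X. \<Sum>j\<in>X. sum u (P i \<inter> P j) * sum u (Q i \<inter> Q j))
       \<le> (\<Sum>i\<in>X. sum u (P i) * sum u (Q i)) + ((\<Sum>i\<in>X. (sum u (P i))\<^sup>2) + (\<Sum>i\<in>X. (sum u (Q i))\<^sup>2)) / 2 + n"
      by (simp add: add_divide_distrib)
    also have "(\<Sum>i\<in>X. sum u (P i) * sum u (Q i)) + ((\<Sum>i\<in>X. (sum u (P i))\<^sup>2) + (\<Sum>i\<in>X. (sum u (Q i))\<^sup>2)) / 2
       = (\<Sum>i\<in>X. (sum u (P i) + sum u (Q i))\<^sup>2) / 2"
      by (simp add: power2_sum sum.distrib sum_distrib_left flip: mult.assoc) (simp add: sum_distrib_left[symmetric] mult.assoc)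
    also have "\<dots> = W / 2" unfolding W_def using UPQ by simp
    finally show ?thesis using Wn n by linarith
  qed
  have "(W / 8)\<^sup>2 \<le> (\<Sum>i\<in>X. sum u (P i) * sum u (Q i))\<^sup>2"
    using Tlow Wn by (intro power_mono) auto
  also have "\<dots> \<le> (sum u Y)\<^sup>2 * (2 * W)"
    using CS Sigma by (smt (verit) mult_left_mono zero_le_power2)
  also have "\<dots> \<le> (n / \<delta>)\<^sup>2 * (2 * W)"
    using uY uY0 Wn by (intro mult_right_mono power_mono) auto
  finally have "W * W \<le> W * (128 * (n / \<delta>)\<^sup>2)" by (simp add: power2_eq_square mult_ac)
  moreover have "W > 0" using Wn n by linarith
  ultimately have "W \<le> 128 * (n / \<delta>)\<^sup>2" by (simp only: mult_le_cancel_left_pos)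
  then have "real n \<le> 128 * (n / \<delta>)\<^sup>2" using Wn by linarith
  then have "real n * \<delta>\<^sup>2 \<le> real n * (128 * n)" using d0 by (simp add: power_divide field_simps power2_eq_square)
  then show False using big n by (simp only: mult_le_cancel_left_pos of_nat_0_less_iff)
qed

text \<open>A vertex of degree at most \<open>12 * sqrt n\<close> may be deleted, since \<open>n * sqrt n\<close> drops by at least \<open>sqrt n\<close>;
  by \<open>min_degree_bound\<close> and \<open>12\<^sup>2 > 128\<close> such a vertex always exists.\<close>
lemma edges_le_of_no_common_triple:
  fixes f :: "'a \<Rightarrow> 'a \<Rightarrow> real"
  assumes "finite V" "\<forall>e\<in>E. card e = 2"
    and nt: "no_common_triple V (\<lambda>v. {w\<in>V. {v, w} \<in> E}) f"
  shows "real (card {e\<in>E. e \<subseteq> V}) \<le> 12 * (real (card V) * sqrt (real (card V)))"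
  using assms
proof (induction "card V" arbitrary: V)
  case 0
  then have "{e\<in>E. e \<subseteq> V} = {}" by auto
  then show ?case using 0 by (simp only: card.empty)
next
  case (Suc n)
  define m where "m = card V"
  define N where "N v = {w\<in>V. {v, w} \<in> E}" for v
  have m: "m > 0" "m = Suc n" using Suc by (auto simp: m_def)
  have "\<exists>v\<in>V. real (card (N v)) < 12 * sqrt m"
  proof (rule ccontr)
    assume "\<not> ?thesis"
    then have *: "12 * sqrt m \<le> real (card (N v))" if "v \<in> V" for v using that by force
    have eq: "{i\<in>V. a \<in> N i} = N a" if "a \<in> V" for a
      using that by (auto simp: N_def insert_commute)
    have "(12 * sqrt m)\<^sup>2 \<le> 128 * real m"
      using Suc.prems m * eq
      by (intro min_degree_bound[of V V N f m]) (auto simp: N_def[abs_def] m_def)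
    then show False using m by (simp add: power_mult_distrib)
  qed
  then obtain v where v: "v \<in> V" and low: "real (card (N v)) < 12 * sqrt m" by blast
  define V' where "V' = V - {v}"
  have cV': "card V' = n" using v m Suc.prems by (simp add: V'_def m_def)
  have nt': "no_common_triple V' (\<lambda>v. {w\<in>V'. {v, w} \<in> E}) f"
    by (rule no_common_triple_mono[OF Suc.prems(3)]) (auto simp: V'_def)
  have IH: "real (card {e\<in>E. e \<subseteq> V'}) \<le> 12 * (real n * sqrt (real n))"
    using Suc.hyps(1)[of V'] cV' nt' Suc.prems by (auto simp: V'_def)
  have "{e\<in>E. e \<subseteq> V} \<subseteq> {e\<in>E. e \<subseteq> V'} \<union> (\<lambda>w. {v, w}) ` N v"
  proof
    fix e assume e: "e \<in> {e\<in>E. e \<subseteq> V}"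
    show "e \<in> {e\<in>E. e \<subseteq> V'} \<union> (\<lambda>w. {v, w}) ` N v"
    proof (cases "v \<in> e")
      case True
      obtain x y where xy: "e = {x, y}" using e Suc.prems(2) by (auto simp: card_2_iff)
      define w where "w = (if x = v then y else x)"
      have "e = {v, w}" using xy True by (auto simp: w_def)
      then show ?thesis using e by (auto simp: N_def)
    qed (use e in \<open>auto simp: V'_def\<close>)
  qed
  then have "card {e\<in>E. e \<subseteq> V} \<le> card ({e\<in>E. e \<subseteq> V'} \<union> (\<lambda>w. {v, w}) ` N v)"
    using Suc.prems(1) by (intro card_mono) (auto simp: N_def V'_def intro: finite_subset[of _ "Pow V"])
  also have "\<dots> \<le> card {e\<in>E. e \<subseteq> V'} + card (N v)"
    using card_Un_le[of "{e\<in>E. e \<subseteq> V'}" "(\<lambda>w. {v, w}) ` N v"] card_image_le[of "N v" "\<lambda>w. {v, w}"]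
      Suc.prems(1) by (simp add: N_def)
  finally have "real (card {e\<in>E. e \<subseteq> V}) \<le> 12 * (real n * sqrt n) + 12 * sqrt m"
    using IH low by linarith
  also have "\<dots> \<le> 12 * (real n * sqrt m) + 12 * sqrt m"
    using m by (simp add: mult_left_mono)
  also have "\<dots> = 12 * (real m * sqrt m)" using m by (simp add: algebra_simps)
  finally show ?case by (simp add: m_def)
qed

section \<open>Winding numbers at a corner of a Jordan curve\<close>

lemma winding_number_join3:
  assumes "path p" "path q" "path r" "pathfinish p = pathstart q" "pathfinish q = pathstart r"
    and "z \<notin> path_image p" "z \<notin> path_image q" "z \<notin> path_image r"
  shows "winding_number (p +++ q +++ r) z = winding_number p z + winding_number q z + winding_number r z"
  using assms by (simp add: winding_number_join not_in_path_image_join)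

text \<open>The initial piece of an edge at its end point \<open>c\<close>, up to the first point on the circle of radius \<open>r\<close>.
  The angle \<open>t\<close> of that point is an argument and not an equivalence class, so that turning by \<open>2 * pi\<close>
  gives the same spoke a second angle.\<close>
definition spoke :: "complex \<Rightarrow> real \<Rightarrow> (real \<Rightarrow> complex) \<Rightarrow> real \<Rightarrow> bool" where
  "spoke c r s t \<longleftrightarrow> arc s \<and> pathstart s = c \<and> pathfinish s = c + of_real r * cis t \<and>
     path_image s - {pathfinish s} \<subseteq> ball c r"

text \<open>The boundary of the sector from angle \<open>t\<close> counterclockwise to \<open>t'\<close>, traversed counterclockwise: out
  along the first spoke, along the circle, and back along the second spoke.\<close>
definition sector_loop :: "complex \<Rightarrow> real \<Rightarrow> (real \<Rightarrow> complex) \<Rightarrow> (real \<Rightarrow> complex) \<Rightarrow> real \<Rightarrow> real \<Rightarrow> real \<Rightarrow> complex" where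
  "sector_loop c r s s' t t' = s +++ part_circlepath c r t t' +++ reversepath s'"

text \<open>Bounding the angles to one turn leaves only one candidate parameter for the point.\<close>
lemma circle_point_on_arc:
  assumes "r > 0" "t1 \<le> t2" "t2 < t1 + 2 * pi" "t1 \<le> t" "t < t1 + 2 * pi"
  shows "c + of_real r * cis t \<in> path_image (part_circlepath c r t1 t2) \<longleftrightarrow> t \<le> t2"
proof
  assume "c + of_real r * cis t \<in> path_image (part_circlepath c r t1 t2)"
  then obtain x where x: "t1 \<le> x" "x \<le> t2" "cis t = cis x"
    using assms by (auto simp: path_image_part_circlepath' closed_segment_eq_real_ivl)
  then have "exp (\<i> * of_real t) = exp (\<i> * of_real x)" by (simp add: cis_conv_exp)
  then obtain n :: int where n: "\<i> * of_real t = \<i> * of_real x + (of_int (2 * n) * pi) * \<i>"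
    by (auto simp: exp_eq)
  then have "t = x + 2 * n * pi"
    by (auto simp: complex_eq_iff)
  moreover have "\<bar>t - x\<bar> < 2 * pi" using x assms by auto
  ultimately have "\<bar>real_of_int n\<bar> < 1" by (simp add: abs_mult)
  then have "n = 0" by linarith
  then show "t \<le> t2" using \<open>t = x + 2 * n * pi\<close> x by simp
next
  assume "t \<le> t2"
  then show "c + of_real r * cis t \<in> path_image (part_circlepath c r t1 t2)"
    using assms by (auto simp: path_image_part_circlepath' closed_segment_eq_real_ivl)
qed

lemma pathstart_part_circlepath_cis: "pathstart (part_circlepath c r t t') = c + of_real r * cis t"
  and pathfinish_part_circlepath_cis: "pathfinish (part_circlepath c r t t') = c + of_real r * cis t'"
  by (simp_all add: cis_conv_exp)

lemma spokeD:
  assumes "spoke c r s t"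
  shows "arc s" "path s" "pathstart s = c" "pathfinish s = c + of_real r * cis t"
    "path_image s - {c + of_real r * cis t} \<subseteq> ball c r" "c \<in> path_image s" "c + of_real r * cis t \<in> path_image s"
  using assms pathstart_in_path_image[of s] pathfinish_in_path_image[of s] by (auto simp: spoke_def arc_imp_path)

lemma spoke_meets_circle:
  assumes "spoke c r s t" "r > 0" "z \<in> path_image s" "z \<in> sphere c r"
  shows "z = c + of_real r * cis t"
  using spokeD(5)[OF assms(1)] assms(3,4) by force

lemma sector_loop_basic:
  assumes r: "r > 0" and s: "spoke c r s t" "spoke c r s' t'"
  shows "path (sector_loop c r s s' t t')"
    "pathfinish (sector_loop c r s s' t t') = pathstart (sector_loop c r s s' t t')"
    "path_image (sector_loop c r s s' t t') = path_image s \<union> path_image (part_circlepath c r t t') \<union> path_image s'"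
  using spokeD[OF s(1)] spokeD[OF s(2)]
  by (auto simp: sector_loop_def path_image_join pathstart_part_circlepath_cis pathfinish_part_circlepath_cis
      simp del: pathstart_part_circlepath pathfinish_part_circlepath)

lemma sector_loop_simple:
  assumes r: "r > 0" and s: "spoke c r s t" "spoke c r s' t'" and t: "t < t'" "t' < t + 2 * pi"
    and disj: "path_image s \<inter> path_image s' = {c}"
  shows "simple_path (sector_loop c r s s' t t')"
  unfolding sector_loop_def
proof (rule simple_path_join3I)
  note S = spokeD[OF s(1)] and S' = spokeD[OF s(2)]
  show "arc s" "arc (reversepath s')" using S S' by (auto simp: arc_reversepath)
  show "arc (part_circlepath c r t t')" using r t by (intro arc_part_circlepath) auto
  have C: "path_image (part_circlepath c r t t') \<subseteq> sphere c r"
    using r t by (intro path_image_part_circlepath_subset) auto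
  show "path_image s \<inter> path_image (part_circlepath c r t t') \<subseteq> {pathstart (part_circlepath c r t t')}"
    using C spoke_meets_circle[OF s(1) r] unfolding pathstart_part_circlepath_cis by blast
  show "path_image (part_circlepath c r t t') \<inter> path_image (reversepath s') \<subseteq> {pathstart (reversepath s')}"
    using C spoke_meets_circle[OF s(2) r]
    unfolding path_image_reversepath pathstart_reversepath S'(4) by blast
  show "path_image s \<inter> path_image (reversepath s') \<subseteq> {pathstart s} \<inter> {pathfinish (reversepath s')}"
    using disj S(3) S'(3) by simp
  show "pathfinish s = pathstart (part_circlepath c r t t')"
    by (simp only: S(4) pathstart_part_circlepath_cis)
  show "pathfinish (part_circlepath c r t t') = pathstart (reversepath s')"
    by (simp only: S'(4) pathfinish_part_circlepath_cis pathstart_reversepath)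
qed

lemma cis_turn: "cis (t + 2 * pi) = cis t"
  by (simp flip: cis_mult)

text \<open>The two arcs make up the full circle. Each arc winds by a positive amount around \<open>p\<close>, and a simple
  closed path of positive winding number winds exactly once.\<close>
lemma winding_number_two_arcs:
  assumes r: "r > 0" and p: "p \<in> ball c r" and t: "t < t'" "t' < t + 2 * pi"
  shows "winding_number (part_circlepath c r t t') p + winding_number (part_circlepath c r t' (t + 2 * pi)) p = 1"
proof -
  let ?A = "part_circlepath c r t t'" and ?B = "part_circlepath c r t' (t + 2 * pi)"
  have nin: "p \<notin> path_image (part_circlepath c r x y)" for x y
    using path_image_part_circlepath_subset'[of r c x y] r p by auto
  have arcs: "arc ?A" "arc ?B" using r t by (auto intro!: arc_part_circlepath)
  have ends: "pathfinish ?A = pathstart ?B" "pathfinish ?B = pathstart ?A"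
    by (simp_all only: pathstart_part_circlepath_cis pathfinish_part_circlepath_cis cis_turn)
  have "path_image ?A \<inter> path_image ?B \<subseteq> {pathstart ?A, pathstart ?B}"
  proof
    fix z assume z: "z \<in> path_image ?A \<inter> path_image ?B"
    then obtain x where x: "t' \<le> x" "x \<le> t + 2 * pi" "z = c + of_real r * cis x"
      using t by (auto simp: path_image_part_circlepath' closed_segment_eq_real_ivl)
    show "z \<in> {pathstart ?A, pathstart ?B}"
    proof (cases "x = t + 2 * pi")
      case True
      then have "z = pathstart ?A" using x by (simp only: pathstart_part_circlepath_cis cis_turn)
      then show ?thesis by blast
    next
      case False
      then have "x \<le> t'" using z x t r circle_point_on_arc[of r t t' x c] by auto
      then have "x = t'" using x by simp
      then have "z = pathstart ?B" using x by (simp only: pathstart_part_circlepath_cis)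
      then show ?thesis by blast
    qed
  qed
  then have sim: "simple_path (?A +++ ?B)" using arcs ends by (intro simple_path_join_loop)
  have sum: "winding_number (?A +++ ?B) p = winding_number ?A p + winding_number ?B p"
    using ends nin by (intro winding_number_join) auto
  have "0 < Re (winding_number ?A p)" "0 < Re (winding_number ?B p)"
    using p t by (auto intro!: winding_number_part_circlepath_pos_less simp: dist_norm norm_minus_commute)
  then have "0 < Re (winding_number (?A +++ ?B) p)" unfolding sum by simp
  then have "winding_number (?A +++ ?B) p = 1"
    using sim ends nin by (intro simple_closed_path_winding_number_pos) (auto simp: path_image_join)
  then show ?thesis using sum by simp
qed

text \<open>The spokes cancel in the two complementary sector loops, which leaves the full circle.\<close>
lemma sector_loop_winding_sum:
  assumes r: "r > 0" and s: "spoke c r s t" "spoke c r s' t'" and t: "t < t'" "t' < t + 2 * pi"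
    and p: "p \<in> ball c r" "p \<notin> path_image s" "p \<notin> path_image s'"
  shows "winding_number (sector_loop c r s s' t t') p + winding_number (sector_loop c r s' s t' (t + 2 * pi)) p = 1"
proof -
  have nin: "p \<notin> path_image (part_circlepath c r x y)" for x y
    using path_image_part_circlepath_subset'[of r c x y] r p by auto
  note S = spokeD[OF s(1)] and S' = spokeD[OF s(2)]
  have "winding_number (sector_loop c r s s' t t') p =
    winding_number s p + winding_number (part_circlepath c r t t') p - winding_number s' p"
    unfolding sector_loop_def using S S' p nin
    by (subst winding_number_join3)
      (auto simp: winding_number_reversepath pathstart_part_circlepath_cis pathfinish_part_circlepath_cis
        simp del: pathstart_part_circlepath pathfinish_part_circlepath)
  moreover have "winding_number (sector_loop c r s' s t' (t + 2 * pi)) p =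
    winding_number s' p + winding_number (part_circlepath c r t' (t + 2 * pi)) p - winding_number s p"
    unfolding sector_loop_def using S S' p nin
    by (subst winding_number_join3)
      (auto simp: winding_number_reversepath pathstart_part_circlepath_cis pathfinish_part_circlepath_cis cis_turn
        simp del: pathstart_part_circlepath pathfinish_part_circlepath)
  ultimately have "winding_number (sector_loop c r s s' t t') p + winding_number (sector_loop c r s' s t' (t + 2 * pi)) p
     = winding_number (part_circlepath c r t t') p + winding_number (part_circlepath c r t' (t + 2 * pi)) p"
    by simp
  also have "\<dots> = 1" by (rule winding_number_two_arcs[OF r p(1) t])
  finally show ?thesis .
qed

lemma spoke_turn: "spoke c r s (t + 2 * pi) \<longleftrightarrow> spoke c r s t"
  by (simp add: spoke_def flip: cis_mult)

text \<open>This fixes the orientation of sector loops, although spokes may be wild: two complementary ones have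
  winding numbers in \<open>{-1, 0, 1}\<close> that add up to \<open>1\<close>.\<close>
lemma sector_loop_winding_01:
  assumes r: "r > 0" and s: "spoke c r s t" "spoke c r s' t'" and t: "t < t'" "t' < t + 2 * pi"
    and disj: "path_image s \<inter> path_image s' = {c}"
    and p: "p \<in> ball c r" "p \<notin> path_image s" "p \<notin> path_image s'"
  shows "winding_number (sector_loop c r s s' t t') p \<in> {0, 1}"
proof -
  have nin: "p \<notin> path_image (part_circlepath c r x y)" for x y
    using path_image_part_circlepath_subset'[of r c x y] r p by auto
  have s2: "spoke c r s (t + 2 * pi)" using s by (simp add: spoke_turn)
  have 1: "winding_number (sector_loop c r s s' t t') p \<in> {-1, 0, 1}"
    using sector_loop_simple[OF r s t disj] sector_loop_basic[OF r s] p nin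
    by (intro simple_closed_path_winding_number_cases) auto
  have 2: "winding_number (sector_loop c r s' s t' (t + 2 * pi)) p \<in> {-1, 0, 1}"
    using sector_loop_simple[OF r s(2) s2] sector_loop_basic[OF r s(2) s2] p nin t disj
    by (intro simple_closed_path_winding_number_cases) auto
  from 1 2 sector_loop_winding_sum[OF r s t p]
  show ?thesis by auto
qed

text \<open>The Jordan curve theorem puts the centre on the frontier of the inside.\<close>
lemma sector_loop_near_centre:
  assumes r: "r > 0" and s: "spoke c r s t" "spoke c r s' t'" and t: "t < t'" "t' < t + 2 * pi"
    and disj: "path_image s \<inter> path_image s' = {c}" and e: "0 < e" "e \<le> r"
  obtains q where "q \<in> ball c e" "q \<notin> path_image s" "q \<notin> path_image s'"
    "winding_number (sector_loop c r s s' t t') q = 1"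
proof -
  let ?L = "sector_loop c r s s' t t'"
  have sim: "simple_path ?L" by (rule sector_loop_simple[OF r s t disj])
  note B = sector_loop_basic[OF r s]
  have "frontier (inside (path_image ?L)) = path_image ?L"
    using Jordan_inside_outside[OF sim B(2)] by (elim conjE)
  moreover have "c \<in> path_image ?L" unfolding B(3) using spokeD(6)[OF s(1)] by blast
  ultimately have "c \<in> frontier (inside (path_image ?L))" by (simp only:)
  then have "c \<in> closure (inside (path_image ?L))" unfolding frontier_def by (rule DiffD1)
  then obtain q where q: "q \<in> inside (path_image ?L)" "dist q c < e"
    using e(1) closure_approachable[of c "inside (path_image ?L)"] by blast
  have "q \<notin> path_image ?L" using q(1) inside_no_overlap[of "path_image ?L"] by blast
  then have nq: "q \<notin> path_image s" "q \<notin> path_image s'" unfolding B(3) by simp_all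
  have "q \<in> ball c r" using q(2) e(2) by (simp add: dist_commute)
  then have "winding_number ?L q \<in> {0, 1}"
    by (rule sector_loop_winding_01[OF r s t disj _ nq])
  moreover have "norm (winding_number ?L q) = 1"
    by (rule simple_closed_path_norm_winding_number_inside[OF sim q(1)])
  ultimately have "winding_number ?L q = 1" by force
  moreover have "q \<in> ball c e" using q(2) by (simp add: dist_commute)
  ultimately show thesis using nq that by blast
qed

lemma connected_arc_minus_start:
  assumes "arc g" shows "connected (path_image g - {pathstart g})"
proof -
  have "path_image g - {pathstart g} = g ` {0<..1}"
  proof -
    have inj: "inj_on g {0..1}" using assms by (simp add: arc_def)
    have "g x \<noteq> g 0" if "0 < x" "x \<le> 1" for x
      using inj_onD[OF inj, of x 0] that by force
    moreover have "{0..1} = insert 0 {0<..1::real}" by force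
    ultimately show ?thesis by (force simp: path_image_def pathstart_def)
  qed
  moreover have "continuous_on {0<..1} g"
    using assms continuous_on_subset[of "{0..1}" g "{0<..1}"] by (force simp: arc_def path_def)
  ultimately show ?thesis by (simp add: connected_continuous_image)
qed

text \<open>The third spoke ends on the circle outside the sector, and from there a ray leads to infinity; neither
  the spoke without the centre nor the ray meets the boundary of the sector.\<close>
lemma third_spoke_outside:
  assumes r: "r > 0" and s: "spoke c r s t" "spoke c r s' t'" "spoke c r s'' t''"
    and t: "t < t'" "t' < t''" "t'' < t + 2 * pi"
    and disj: "path_image s \<inter> path_image s' = {c}" "path_image s \<inter> path_image s'' = {c}" "path_image s' \<inter> path_image s'' = {c}"
    and p: "p \<in> path_image s''" "p \<noteq> c" 
  shows "winding_number (sector_loop c r s s' t t') p = 0"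
proof -
  let ?L = "sector_loop c r s s' t t'"
  note B = sector_loop_basic[OF r s(1,2)]
  define z where "z = c + of_real r * cis t''"
  have C: "path_image (part_circlepath c r t t') \<subseteq> sphere c r"
    using r t by (intro path_image_part_circlepath_subset) auto
  have zC: "z \<notin> path_image (part_circlepath c r t t')"
    unfolding z_def using t r by (subst circle_point_on_arc) auto
  define S where "S = path_image s'' - {c}"
  have conn: "connected S"
    using connected_arc_minus_start[OF spokeD(1)[OF s(3)]] spokeD(3)[OF s(3)] by (simp add: S_def)
  have SL: "S \<inter> path_image ?L = {}"
  proof -
    have "x \<notin> path_image (part_circlepath c r t t')" if "x \<in> path_image s''" for x
      using spoke_meets_circle[OF s(3) r that] C zC by (auto simp: z_def)
    then show ?thesis using disj B(3) by (auto simp: S_def)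
  qed
  have zS: "z \<in> S" using spokeD(7)[OF s(3)] r by (auto simp: S_def z_def)
  have "winding_number ?L p = winding_number ?L z"
    using B conn SL zS p by (intro winding_number_eq[where S = S]) (auto simp: S_def)
  also have "\<dots> = 0"
  proof -
    define R where "R = (\<lambda>x. c + of_real x * cis t'') ` {r..}"
    have "connected R" unfolding R_def by (intro connected_continuous_image continuous_intros) auto
    have RL: "R \<inter> path_image ?L = {}"
    proof -
      have cb: "path_image s \<subseteq> cball c r" if "spoke c r s x" for s x
      proof
        fix y assume "y \<in> path_image s"
        then show "y \<in> cball c r"
          using spokeD(5)[OF that] r by (cases "y = c + of_real r * cis x") (auto simp: dist_norm norm_mult)
      qed
      have sub: "path_image ?L \<subseteq> cball c r"
        using cb[OF s(1)] cb[OF s(2)] C B(3) by fastforce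
      have "y \<notin> path_image ?L" if yR: "y \<in> R" for y
      proof
        assume y: "y \<in> path_image ?L"
        obtain x where x: "x \<ge> r" "y = c + of_real x * cis t''" using yR by (auto simp: R_def)
        have "dist c y = x" using x r by (simp add: dist_norm norm_mult)
        then have "x = r" using sub y x by auto
        then have "y = z" using x by (simp add: z_def)
        then show False using y SL zS by blast
      qed
      then show ?thesis by blast
    qed
    obtain M where M: "\<And>z. M \<le> norm z \<Longrightarrow> winding_number ?L z = 0"
      using winding_number_zero_at_infinity[OF B(1,2)] by blast
    define x where "x = max r (norm c + \<bar>M\<bar>)"
    have "c + of_real x * cis t'' \<in> R" by (simp add: R_def x_def)
    moreover have "z \<in> R" by (auto simp: R_def z_def)
    moreover have "M \<le> norm (c + of_real x * cis t'')"
    proof -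
      have "norm (of_real x * cis t'') = \<bar>x\<bar>" by (simp add: norm_mult)
      then show ?thesis using norm_triangle_ineq2[of "of_real x * cis t''" "-c"] r by (simp add: x_def add.commute max_def split: if_splits)
    qed
    ultimately show ?thesis
      using winding_number_eq[OF B(1,2) _ _ \<open>connected R\<close> RL] M by metis
  qed
  finally show ?thesis .
qed

lemma path_image_split:
  assumes "u \<in> {0..1}"
  shows "path_image g = path_image (subpath 0 u g) \<union> path_image (subpath u 1 g)"
proof -
  have "{0..1} = {0..u} \<union> {u..1}" using assms by (simp add: ivl_disj_un_two_touch)
  then have "g ` {0..1} = g ` {0..u} \<union> g ` {u..1}" by (metis image_Un)
  then show ?thesis using assms by (simp add: path_image_subpath path_image_def[of g])
qed

text \<open>At the corner \<open>c\<close> of the closed path \<open>J\<close>, replace the two spokes of \<open>J\<close> by an arc of the circle. The new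
  closed path \<open>R\<close> stays away from \<open>c\<close>, so its winding number is a constant \<open>n\<close> near \<open>c\<close>; and there \<open>J\<close>
  differs from \<open>R\<close> by the loop around the sector between the spokes. Hence \<open>J\<close> has winding number \<open>n + 1\<close>
  in this sector and \<open>n\<close> in the complementary one. Both values occur, so if \<open>0\<close> and \<open>\<sigma>\<close> are the only
  winding numbers of \<open>J\<close>, then \<open>n\<close> is the smaller of them. A third edge \<open>C\<close> therefore finds the larger value
  exactly if it starts in the sector.\<close>
lemma corner_winding:
  assumes r: "r > 0"
    and A: "arc A" "uA \<in> {0..1}" "spoke c r (subpath 0 uA A) t"
    and B: "arc B" "uB \<in> {0..1}" "spoke c r (subpath 0 uB B) t'"
    and C: "uC \<in> {0..1}" "spoke c r (subpath 0 uC C) t''"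
    and M: "path M" "pathstart M = pathfinish A" "pathfinish M = pathfinish B" "c \<notin> path_image M"
    and AB: "path_image A \<inter> path_image B = {c}"
    and AC: "path_image A \<inter> path_image C = {c}" and BC: "path_image B \<inter> path_image C = {c}"
    and t: "t < t'" "t' < t + 2 * pi" "t \<le> t''" "t'' < t + 2 * pi" "t'' \<noteq> t" "t'' \<noteq> t'"
    and \<sigma>: "\<sigma> \<in> {-1, 1::int}"
    and vals: "\<And>z. z \<notin> path_image (A +++ M +++ reversepath B) \<Longrightarrow>
        winding_number (A +++ M +++ reversepath B) z \<in> {0, of_int \<sigma>}"
  shows "\<exists>p \<in> path_image C - {c}. winding_number (A +++ M +++ reversepath B) p =
      of_int (if t'' < t' then max 0 \<sigma> else min 0 \<sigma>)"
proof -
  let ?J = "A +++ M +++ reversepath B"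
  define s where "s = subpath 0 uA A"
  define s' where "s' = subpath 0 uB B"
  define s'' where "s'' = subpath 0 uC C"
  define rA where "rA = subpath uA 1 A"
  define rB where "rB = subpath uB 1 B"
  define L where "L = sector_loop c r s s' t t'"
  define L' where "L' = sector_loop c r s' s t' (t + 2 * pi)"
  have sp: "spoke c r s t" "spoke c r s' t'" "spoke c r s'' t''"
    using A B C by (simp_all add: s_def s'_def s''_def)
  have pths: "path A" "path B" using A B by (simp_all add: arc_imp_path)
  have sub: "path_image s \<subseteq> path_image A" "path_image s' \<subseteq> path_image B" "path_image s'' \<subseteq> path_image C"
      "path_image rA \<subseteq> path_image A" "path_image rB \<subseteq> path_image B"
    using A(2) B(2) C(1) unfolding s_def s'_def s''_def rA_def rB_def by (simp_all add: path_image_subpath_subset)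
  have starts: "A 0 = c" "B 0 = c"
    using spokeD(3)[OF sp(1)] spokeD(3)[OF sp(2)] by (simp_all add: s_def s'_def pathstart_def subpath_def)
  have ss': "path_image s \<inter> path_image s' = {c}" and ss'': "path_image s \<inter> path_image s'' = {c}"
    and s's'': "path_image s' \<inter> path_image s'' = {c}"
    using AB AC BC sub spokeD(6)[OF sp(1)] spokeD(6)[OF sp(2)] spokeD(6)[OF sp(3)] by blast+
  have rest: "c \<notin> path_image (subpath u 1 g)" if g: "arc g" "u \<in> {0..1}" "spoke c r (subpath 0 u g) x" "g 0 = c" for g u x
  proof
    assume "c \<in> path_image (subpath u 1 g)"
    then obtain y where y: "u \<le> y" "y \<le> 1" "g y = c" using g(2) by (auto simp: path_image_subpath split: if_splits)
    have "inj_on g {0..1}" using g(1) by (simp add: arc_def)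
    then have "y = 0" using inj_onD[of g "{0..1}" y 0] y g(2,4) by simp
    then have "u = 0" using y g(2) by simp
    then show False using spokeD(3,4)[OF g(3)] g(4) r by (simp add: pathfinish_def subpath_def)
  qed
  have crA: "c \<notin> path_image rA" unfolding rA_def by (rule rest[OF A starts(1)])
  have crB: "c \<notin> path_image rB" unfolding rB_def by (rule rest[OF B starts(2)])
  have prA: "path rA" "pathstart rA = pathfinish s" "pathfinish rA = pathfinish A"
    unfolding rA_def s_def using A(2) pths(1) by (simp_all only: path_subpath pathstart_subpath pathfinish_subpath atLeastAtMost_iff) (simp_all add: pathfinish_def)
  have prB: "path rB" "pathstart rB = pathfinish s'" "pathfinish rB = pathfinish B"
    unfolding rB_def s'_def using B(2) pths(2) by (simp_all only: path_subpath pathstart_subpath pathfinish_subpath atLeastAtMost_iff) (simp_all add: pathfinish_def)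
  note S = spokeD[OF sp(1)] and S' = spokeD[OF sp(2)] and S'' = spokeD[OF sp(3)]
  define P where "P = part_circlepath c r t t'"
  have P: "path P" "pathstart P = pathfinish s" "pathfinish P = pathfinish s'" "path_image P \<subseteq> sphere c r"
    unfolding P_def S(4) S'(4) pathstart_part_circlepath_cis pathfinish_part_circlepath_cis
    using r path_image_part_circlepath_subset'[of r c t t'] by simp_all
  define R where "R = rA +++ M +++ reversepath rB +++ reversepath P"
  have R: "path R" "pathfinish R = pathstart R"
    "path_image R = path_image rA \<union> path_image M \<union> path_image rB \<union> path_image P"
    unfolding R_def using prA prB P M by (simp_all add: path_image_join Un_assoc)
  have "c \<notin> path_image P" using P(4) r by auto
  then have "c \<notin> path_image R" using crA crB M(4) R(3) by simp
  then obtain e0 where e0: "e0 > 0" "ball c e0 \<subseteq> - path_image R"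
    using open_contains_ball[of "- path_image R"] closed_path_image[OF R(1)] by (auto simp: open_Compl)
  define e where "e = min e0 r"
  have e: "0 < e" "e \<le> r" "ball c e \<inter> path_image R = {}" using e0 r by (auto simp: e_def)
  define n where "n = winding_number R c"
  have imJ: "path_image ?J = path_image A \<union> path_image M \<union> path_image B"
    using M by (simp add: path_image_join Un_assoc)
  have Asplit: "path_image A = path_image s \<union> path_image rA"
    unfolding s_def rA_def using A(2) by (rule path_image_split)
  have Bsplit: "path_image B = path_image s' \<union> path_image rB"
    unfolding s'_def rB_def using B(2) by (rule path_image_split)
  have key: "p \<notin> path_image ?J \<and> winding_number ?J p = winding_number L p + n"
    if p: "p \<in> ball c e" "p \<notin> path_image s" "p \<notin> path_image s'" for p
  proof -
    have pR: "p \<notin> path_image R" using p e by blast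
    then have ps: "p \<notin> path_image rA" "p \<notin> path_image rB" "p \<notin> path_image M" "p \<notin> path_image P" using R(3) by simp_all
    have pJ: "p \<notin> path_image ?J" using ps p imJ Asplit Bsplit by simp
    have Rn: "winding_number R p = n"
      unfolding n_def using R(1,2) p e by (intro winding_number_eq[where S = "ball c e"]) auto
    have "winding_number R p = winding_number rA p + winding_number M p - winding_number rB p - winding_number P p"
      unfolding R_def using prA prB P M ps
      by (simp add: winding_number_join winding_number_reversepath not_in_path_image_join)
    then have n_eq: "n = winding_number rA p + winding_number M p - winding_number rB p - winding_number P p"
      using Rn by simp
    have wL: "winding_number L p = winding_number s p + winding_number P p - winding_number s' p"
      unfolding L_def sector_loop_def P_def[symmetric] using S S' P ps p
      by (simp add: winding_number_join winding_number_reversepath not_in_path_image_join)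
    have wJ: "winding_number ?J p = winding_number A p + winding_number M p - winding_number B p"
      using M pJ imJ pths by (simp add: winding_number_join winding_number_reversepath not_in_path_image_join)
    have wA: "winding_number A p = winding_number s p + winding_number rA p"
      using winding_number_subpath_combine[of A p 0 uA 1] pths(1) A(2) pJ imJ by (simp add: s_def rA_def)
    have wB: "winding_number B p = winding_number s' p + winding_number rB p"
      using winding_number_subpath_combine[of B p 0 uB 1] pths(2) B(2) pJ imJ by (simp add: s'_def rB_def)
    have "winding_number ?J p = winding_number L p + n"
      unfolding wJ wA wB wL n_eq by simp
    then show ?thesis using pJ by simp
  qed
  have LL': "winding_number L p + winding_number L' p = 1" if "p \<in> ball c r" "p \<notin> path_image s" "p \<notin> path_image s'" for p
    unfolding L_def L'_def by (rule sector_loop_winding_sum[OF r sp(1,2) t(1,2) that])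
  have sp': "spoke c r s (t + 2 * pi)" using sp(1) by (simp only: spoke_turn)
  \<comment> \<open>Both sectors come arbitrarily close to \<open>c\<close>, so \<open>n\<close> and \<open>n + 1\<close> are both values of the winding number.\<close>
  have n: "n = of_int (min 0 \<sigma>)"
  proof -
    obtain q where q: "q \<in> ball c e" "q \<notin> path_image s" "q \<notin> path_image s'" "winding_number L q = 1"
      using sector_loop_near_centre[OF r sp(1,2) t(1,2) ss' e(1,2)] unfolding L_def by blast
    have "1 + n \<in> {0, of_int \<sigma>}" using key[OF q(1-3)] vals[of q] q(4) by simp
    moreover
    have t2: "t + 2 * pi < t' + 2 * pi" using t by simp
    obtain q' where q': "q' \<in> ball c e" "q' \<notin> path_image s'" "q' \<notin> path_image s" "winding_number L' q' = 1"
      using sector_loop_near_centre[OF r sp(2) sp' t(2) t2 _ e(1,2)] ss' unfolding L'_def by (metis Int_commute)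
    have "q' \<in> ball c r" using q'(1) e(2) by auto
    then have "winding_number L q' = 0" using LL'[of q'] q' by simp
    then have "n \<in> {0, of_int \<sigma>}" using key[OF q'(1,3,2)] vals[of q'] by simp
    ultimately show ?thesis using \<sigma> by auto
  qed
  have conn: "connected (path_image s'')" using S''(2) by (simp add: connected_path_image)
  have "path_image s'' \<noteq> {x}" for x
  proof
    assume "path_image s'' = {x}"
    then have "c = c + of_real r * cis t''" using S''(6,7) by simp
    then show False using r by simp
  qed
  from connected_imp_perfect[OF conn S''(6) this] have "c islimpt path_image s''" .
  then obtain p where p: "p \<in> path_image s''" "p \<noteq> c" "dist p c < e"
    using e(1) unfolding islimpt_approachable by blast
  have pe: "p \<in> ball c e" and pr: "p \<in> ball c r" using p(3) e(2) by (simp_all add: dist_commute)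
  have ps: "p \<notin> path_image s" "p \<notin> path_image s'" using p ss'' s's'' by blast+
  have pJ: "winding_number ?J p = winding_number L p + n" using key[OF pe ps] by simp
  have "winding_number L p = (if t'' < t' then 1 else 0)"
  proof (cases "t'' < t'")
    case False
    then show ?thesis
      using third_spoke_outside[OF r sp t(1) _ t(4) ss' ss'' s's'' p(1,2)] t(6) by (simp add: L_def)
  next
    case True
    \<comment> \<open>One turn further, the third spoke lies outside the complementary sector.\<close>
    have sp2: "spoke c r s'' (t'' + 2 * pi)" using sp(3) by (simp only: spoke_turn)
    have "winding_number L' p = 0"
      unfolding L'_def
    proof (rule third_spoke_outside[OF r sp(2) sp' sp2 t(2) _ _ _ s's'' ss'' p(1,2)])
      show "t + 2 * pi < t'' + 2 * pi" "t'' + 2 * pi < t' + 2 * pi" using t True by simp_all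
      show "path_image s' \<inter> path_image s = {c}" using ss' by (simp add: Int_commute)
    qed
    then show ?thesis using LL'[OF pr ps] True by simp
  qed
  then have "winding_number ?J p = of_int (if t'' < t' then max 0 \<sigma> else min 0 \<sigma>)"
    using pJ n \<sigma> by auto
  moreover have "p \<in> path_image C - {c}" using p sub by blast
  ultimately show ?thesis by blast
qed

text \<open>The curve \<open>u a v b\<close> is read once from \<open>u\<close> and once from \<open>v\<close>. At \<open>u\<close> its left side is the sector from \<open>a\<close>
  counterclockwise to \<open>b\<close>, at \<open>v\<close> it is the sector from \<open>b\<close> to \<open>a\<close>. If \<open>a\<close>, \<open>b\<close>, \<open>c\<close> had the same
  cyclic order at both ends, then the path \<open>u c v\<close> would start on the right and end on the left of the
  curve without meeting it in between.\<close>
lemma opposite_rotation: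
  fixes Au Bu Cu Av Bv Cv :: "real \<Rightarrow> complex"
  assumes arcs: "arc Au" "arc Bu" "arc Cu" "arc Av" "arc Bv" "arc Cv"
    and ends: "pathstart Au = u" "pathstart Bu = u" "pathstart Cu = u"
      "pathstart Av = v" "pathstart Bv = v" "pathstart Cv = v"
      "pathfinish Au = a" "pathfinish Av = a" "pathfinish Bu = b" "pathfinish Bv = b"
      "pathfinish Cu = c" "pathfinish Cv = c"
    and dist: "u \<noteq> v"
    and u: "path_image Au \<inter> path_image Bu = {u}" "path_image Au \<inter> path_image Cu = {u}" "path_image Bu \<inter> path_image Cu = {u}"
    and v: "path_image Av \<inter> path_image Bv = {v}" "path_image Av \<inter> path_image Cv = {v}" "path_image Bv \<inter> path_image Cv = {v}"
    and abc: "path_image Au \<inter> path_image Av = {a}" "path_image Bu \<inter> path_image Bv = {b}" 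
    and uv: "path_image Au \<inter> path_image Bv = {}" "path_image Au \<inter> path_image Cv = {}" "path_image Bu \<inter> path_image Av = {}"
       "path_image Bu \<inter> path_image Cv = {}" "path_image Cu \<inter> path_image Av = {}" "path_image Cu \<inter> path_image Bv = {}"
    and r: "r > 0" "r' > 0"
    and su: "xa \<in> {0..1}" "spoke u r (subpath 0 xa Au) ta" "xb \<in> {0..1}" "spoke u r (subpath 0 xb Bu) tb"
        "xc \<in> {0..1}" "spoke u r (subpath 0 xc Cu) tc"
    and sv: "ya \<in> {0..1}" "spoke v r' (subpath 0 ya Av) wa" "yb \<in> {0..1}" "spoke v r' (subpath 0 yb Bv) wb"
        "yc \<in> {0..1}" "spoke v r' (subpath 0 yc Cv) wc"
    and t: "ta < tb" "tb < tc" "tc < ta + 2 * pi" and w: "wa < wb" "wb < wc" "wc < wa + 2 * pi"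
  shows False
proof -
  define Ju where "Ju = Au +++ (reversepath Av +++ Bv) +++ reversepath Bu"
  define Jv where "Jv = Bv +++ (reversepath Bu +++ Au) +++ reversepath Av"
  have paths: "path Au" "path Bu" "path Cu" "path Av" "path Bv" "path Cv" using arcs by (simp_all add: arc_imp_path)
  have imu: "path_image Ju = path_image Au \<union> path_image Bu \<union> path_image Av \<union> path_image Bv"
    unfolding Ju_def using ends by (simp add: path_image_join) blast
  have imv: "path_image Jv = path_image Au \<union> path_image Bu \<union> path_image Av \<union> path_image Bv"
    unfolding Jv_def using ends by (simp add: path_image_join) blast
  have mem: "u \<in> path_image Au" "v \<in> path_image Bv" "u \<in> path_image Bu" "v \<in> path_image Av"
    "c \<in> path_image Cu" "c \<in> path_image Cv"
    using ends pathstart_in_path_image pathfinish_in_path_image by metis+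
  have closed: "pathfinish Ju = pathstart Ju" "pathfinish Jv = pathstart Jv" by (simp_all add: Ju_def Jv_def ends)
  have pJ: "path Ju" unfolding Ju_def using paths ends by simp
  have same: "winding_number Jv z = winding_number Ju z" if "z \<notin> path_image Ju" for z
    using that imu paths ends unfolding Ju_def Jv_def
    by (simp add: winding_number_join winding_number_reversepath not_in_path_image_join)
  have simple: "simple_path Ju"
    unfolding Ju_def
  proof (rule simple_path_join_loop)
    show "arc Au" by (rule arcs)
    have "arc (reversepath Av +++ Bv)"
      using arcs ends v by (intro arc_join) (auto simp: arc_reversepath)
    then show "arc ((reversepath Av +++ Bv) +++ reversepath Bu)"
      using arcs ends v abc uv by (intro arc_join) (auto simp: arc_reversepath path_image_join)
    show "path_image Au \<inter> path_image ((reversepath Av +++ Bv) +++ reversepath Bu)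
       \<subseteq> {pathstart Au, pathstart ((reversepath Av +++ Bv) +++ reversepath Bu)}"
      using ends abc uv u by (auto simp: path_image_join)
  qed (simp_all add: ends)
  obtain \<sigma> :: int where \<sigma>: "\<sigma> \<in> {-1, 1}" and vals: "\<And>z. z \<notin> path_image Ju \<Longrightarrow> winding_number Ju z \<in> {0, of_int \<sigma>}"
  proof -
    have out: "winding_number Ju z = 0" if "z \<notin> path_image Ju" "z \<notin> inside (path_image Ju)" for z
    proof (rule winding_number_zero_in_outside[OF pJ closed(1)])
      show "z \<in> outside (path_image Ju)" using that inside_Un_outside[of "path_image Ju"] by blast
    qed
    from simple_closed_path_winding_number_inside[OF simple]
    consider "\<forall>z. z \<in> inside(path_image Ju) \<longrightarrow> winding_number Ju z = 1"
      | "\<forall>z. z \<in> inside(path_image Ju) \<longrightarrow> winding_number Ju z = -1" by metis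
    then show thesis
    proof cases
      case 1
      then show thesis using out by (intro that[of 1]) auto
    next
      case 2
      then show thesis using out by (intro that[of "-1"]) auto
    qed
  qed
  have exp: "\<exists>p \<in> path_image Cu - {u}. winding_number Ju p = of_int (if tc < tb then max 0 \<sigma> else min 0 \<sigma>)"
    unfolding Ju_def
  proof (rule corner_winding[OF r(1) arcs(1) su(1,2) arcs(2) su(3,4) su(5,6)])
    show "u \<notin> path_image (reversepath Av +++ Bv)" using uv mem ends dist by (auto simp: path_image_join)
    show "\<And>z. z \<notin> path_image (Au +++ (reversepath Av +++ Bv) +++ reversepath Bu) \<Longrightarrow>
        winding_number (Au +++ (reversepath Av +++ Bv) +++ reversepath Bu) z \<in> {0, of_int \<sigma>}"
      using vals unfolding Ju_def .
    show "path (reversepath Av +++ Bv)" "pathstart (reversepath Av +++ Bv) = pathfinish Au"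
      "pathfinish (reversepath Av +++ Bv) = pathfinish Bu" using paths ends by simp_all
    show "path_image Au \<inter> path_image Bu = {u}" "path_image Au \<inter> path_image Cu = {u}" "path_image Bu \<inter> path_image Cu = {u}"
      by (fact u)+
    show "ta < tb" "tb < ta + 2 * pi" "ta \<le> tc" "tc < ta + 2 * pi" "tc \<noteq> ta" "tc \<noteq> tb"
      using t by simp_all
  qed (rule \<sigma>)
  from exp obtain p where p: "p \<in> path_image Cu - {u}"
    and p': "winding_number Ju p = of_int (if tc < tb then max 0 \<sigma> else min 0 \<sigma>)" by (rule bexE)
  have "\<not> tc < tb" using t by simp
  then have wp: "winding_number Ju p = of_int (min 0 \<sigma>)" using p' by (simp only: if_False)
  \<comment> \<open>Counterclockwise from \<open>b\<close>, the edge to \<open>a\<close> comes one turn later.\<close>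
  have sv': "spoke v r' (subpath 0 ya Av) (wa + 2 * pi)" using sv(2) by (simp only: spoke_turn)
  have exq: "\<exists>p \<in> path_image Cv - {v}. winding_number Jv p = of_int (if wc < wa + 2 * pi then max 0 \<sigma> else min 0 \<sigma>)"
    unfolding Jv_def
  proof (rule corner_winding[OF r(2) arcs(5) sv(3,4) arcs(4) sv(1) sv' sv(5,6)])
    show "v \<notin> path_image (reversepath Bu +++ Au)" using uv mem ends dist by (auto simp: path_image_join)
    show "\<And>z. z \<notin> path_image (Bv +++ (reversepath Bu +++ Au) +++ reversepath Av) \<Longrightarrow>
        winding_number (Bv +++ (reversepath Bu +++ Au) +++ reversepath Av) z \<in> {0, of_int \<sigma>}"
      using vals same imu imv unfolding Jv_def[symmetric] by simp
    show "path (reversepath Bu +++ Au)" "pathstart (reversepath Bu +++ Au) = pathfinish Bv"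
      "pathfinish (reversepath Bu +++ Au) = pathfinish Av" using paths ends by simp_all
    show "path_image Bv \<inter> path_image Av = {v}" using v(1) by (simp only: Int_commute)
    show "path_image Bv \<inter> path_image Cv = {v}" "path_image Av \<inter> path_image Cv = {v}" by (fact v)+
    show "wb < wa + 2 * pi" "wa + 2 * pi < wb + 2 * pi" "wb \<le> wc" "wc < wb + 2 * pi" "wc \<noteq> wb" "wc \<noteq> wa + 2 * pi"
      using w by simp_all
  qed (rule \<sigma>)
  from exq obtain q where q: "q \<in> path_image Cv - {v}"
    and q': "winding_number Jv q = of_int (if wc < wa + 2 * pi then max 0 \<sigma> else min 0 \<sigma>)" by (rule bexE)
  have wq: "winding_number Jv q = of_int (max 0 \<sigma>)" using q' w(3) by (simp only: if_True)
  have "path_image Cu \<inter> path_image Au = {u}" "path_image Cu \<inter> path_image Bu = {u}"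
      "path_image Cv \<inter> path_image Av = {v}" "path_image Cv \<inter> path_image Bv = {v}"
      "path_image Cv \<inter> path_image Au = {}" "path_image Cv \<inter> path_image Bu = {}"
    using u v uv by (simp_all only: Int_commute)
  then have nCu: "path_image Cu \<inter> path_image Ju = {u}" and nCv: "path_image Cv \<inter> path_image Ju = {v}"
    unfolding imu Int_Un_distrib using uv(5,6) by simp_all
  have conn: "connected ((path_image Cu - {u}) \<union> (path_image Cv - {v}))"
  proof (rule connected_Un)
    show "connected (path_image Cu - {u})" "connected (path_image Cv - {v})"
      using connected_arc_minus_start[OF arcs(3)] connected_arc_minus_start[OF arcs(6)] ends by simp_all
    have "c \<noteq> u" "c \<noteq> v" using mem arc_distinct_ends[OF arcs(3)] arc_distinct_ends[OF arcs(6)] ends by auto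
    then show "(path_image Cu - {u}) \<inter> (path_image Cv - {v}) \<noteq> {}" using mem by blast
  qed
  have "winding_number Ju p = winding_number Ju q"
  proof (rule winding_number_eq[OF pJ closed(1) _ _ conn])
    show "((path_image Cu - {u}) \<union> (path_image Cv - {v})) \<inter> path_image Ju = {}" using nCu nCv by blast
  qed (use p q in simp_all)
  moreover have "winding_number Jv q = winding_number Ju q" using nCv q by (intro same) blast
  ultimately have "(of_int (min 0 \<sigma>) :: complex) = of_int (max 0 \<sigma>)" using wp wq by simp
  then show False using \<sigma> by auto
qed

lemma spoke_exists:
  assumes g: "arc g" "pathstart g = c" and r: "0 < r" "r \<le> dist c (pathfinish g)"
  shows "\<exists>t x. -pi < t \<and> t \<le> pi \<and> x \<in> {0..1} \<and> spoke c r (subpath 0 x g) t"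
proof -
  have "path g" using g by (simp add: arc_imp_path)
  moreover have "pathstart g \<in> closure (ball c r)" using g r by simp
  moreover have "pathfinish g \<notin> ball c r" using r by simp
  ultimately obtain x where x: "0 \<le> x" "x \<le> 1" "g x \<in> frontier (ball c r)"
      "path_image (subpath 0 x g) - {g x} \<subseteq> interior (ball c r)"
    by (rule subpath_to_frontier)
  have gx: "dist c (g x) = r" using x(3) r by (simp add: frontier_ball)
  then have "x \<noteq> 0" using g r by (auto simp: pathstart_def)
  define t where "t = Arg (g x - c)"
  have "norm (g x - c) = r" using gx by (simp add: dist_norm norm_minus_commute)
  moreover from this have "g x - c \<noteq> 0" using r by auto
  ultimately have "g x - c = of_real r * cis t"
    using Arg_eq[of "g x - c"] by (simp add: t_def cis_conv_exp)
  then have "g x = c + of_real r * cis t" by (simp add: algebra_simps)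
  moreover have "arc (subpath 0 x g)" using g x \<open>x \<noteq> 0\<close> by (intro arc_subpath_arc) auto
  ultimately have "spoke c r (subpath 0 x g) t"
    using x g by (simp add: spoke_def pathfinish_def pathstart_def subpath_def)
  moreover have "-pi < t" "t \<le> pi" using mpi_less_Arg Arg_le_pi by (auto simp: t_def)
  ultimately show ?thesis using x by auto
qed

section \<open>Rotations of a topological graph\<close>

definition edge_from :: "(complex set \<Rightarrow> real \<Rightarrow> complex) \<Rightarrow> complex \<Rightarrow> complex \<Rightarrow> real \<Rightarrow> complex" where
  "edge_from \<gamma> u w = (if pathstart (\<gamma> {u, w}) = u then \<gamma> {u, w} else reversepath (\<gamma> {u, w}))"

lemma edge_from:
  assumes "topological_graph V E \<gamma>" "{u, w} \<in> E"
  shows "arc (edge_from \<gamma> u w)" "pathstart (edge_from \<gamma> u w) = u" "pathfinish (edge_from \<gamma> u w) = w"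
    "path_image (edge_from \<gamma> u w) = path_image (\<gamma> {u, w})"
proof -
  have g: "arc (\<gamma> {u, w})" "{pathstart (\<gamma> {u, w}), pathfinish (\<gamma> {u, w})} = {u, w}"
    using assms by (auto simp: topological_graph_def)
  show "arc (edge_from \<gamma> u w)" "path_image (edge_from \<gamma> u w) = path_image (\<gamma> {u, w})"
    using g(1) by (simp_all add: edge_from_def arc_reversepath)
  show "pathstart (edge_from \<gamma> u w) = u" "pathfinish (edge_from \<gamma> u w) = w"
    using g(2) by (auto simp: edge_from_def doubleton_eq_iff)
qed

lemma four_cycle_edges_meet:
  assumes G: "topological_graph V E \<gamma>" and F: "four_cycle E F" "\<not> self_crossing_four_cycle E \<gamma> F"
    and ef: "e \<in> F" "f \<in> F" "e \<noteq> f"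
  shows "path_image (\<gamma> e) \<inter> path_image (\<gamma> f) = e \<inter> f"
proof -
  have E: "e \<in> E" "f \<in> E" using F(1) ef by (auto simp: four_cycle_def)
  have V: "e \<subseteq> V" "f \<subseteq> V" using G E by (auto simp: topological_graph_def simple_graph_def)
  have img: "path_image (\<gamma> x) = arc_interior (\<gamma> x) \<union> x" "arc_interior (\<gamma> x) \<inter> V = {}" if "x \<in> E" for x
  proof -
    have "{pathstart (\<gamma> x), pathfinish (\<gamma> x)} = x" "arc_interior (\<gamma> x) \<inter> V = {}"
      using G that by (simp_all add: topological_graph_def)
    moreover have "{pathstart (\<gamma> x), pathfinish (\<gamma> x)} \<subseteq> path_image (\<gamma> x)"
      by (simp add: pathstart_in_path_image pathfinish_in_path_image)
    ultimately show "path_image (\<gamma> x) = arc_interior (\<gamma> x) \<union> x" "arc_interior (\<gamma> x) \<inter> V = {}"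
      unfolding arc_interior_def by auto
  qed
  have "arc_interior (\<gamma> e) \<inter> arc_interior (\<gamma> f) = {}"
    using F ef by (auto simp: self_crossing_four_cycle_def)
  then show ?thesis using img[OF E(1)] img[OF E(2)] V by blast
qed

text \<open>Any two of the four edges lie on the four-cycle \<open>u x v y\<close>, so they meet only in common end points.\<close>
lemma common_neighbours_disjoint:
  assumes G: "topological_graph V E \<gamma>" and nF: "\<not> (\<exists>F. self_crossing_four_cycle E \<gamma> F)"
    and E: "{u, x} \<in> E" "{v, x} \<in> E" "{u, y} \<in> E" "{v, y} \<in> E" and ne: "u \<noteq> v" "x \<noteq> y"
  shows "path_image (\<gamma> {u, x}) \<inter> path_image (\<gamma> {u, y}) = {u}"
    "path_image (\<gamma> {u, x}) \<inter> path_image (\<gamma> {v, x}) = {x}"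
    "path_image (\<gamma> {u, x}) \<inter> path_image (\<gamma> {v, y}) = {}"
proof -
  have c2: "card e = 2" if "e \<in> E" for e using G that by (auto simp: topological_graph_def simple_graph_def)
  have d: "u \<noteq> x" "v \<noteq> x" "u \<noteq> y" "v \<noteq> y" using c2[OF E(1)] c2[OF E(2)] c2[OF E(3)] c2[OF E(4)] by auto
  define F where "F = {{u, x}, {x, v}, {v, y}, {y, u}}"
  have "four_cycle E F"
    unfolding four_cycle_def F_def using E ne d
    by (intro exI[of _ u] exI[of _ x] exI[of _ v] exI[of _ y]) (auto simp: insert_commute)
  note meet = four_cycle_edges_meet[OF G this, of "{u, x}"]
  have F: "{u, x} \<in> F" "{v, x} \<in> F" "{u, y} \<in> F" "{v, y} \<in> F" by (auto simp: F_def insert_commute)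
  have ne': "{u, x} \<noteq> {u, y}" "{u, x} \<noteq> {v, x}" "{u, x} \<noteq> {v, y}" using ne d by (auto simp: doubleton_eq_iff)
  have nF': "\<not> self_crossing_four_cycle E \<gamma> F" using nF by blast
  have "{u, x} \<inter> {u, y} = {u}" using ne d by blast
  then show "path_image (\<gamma> {u, x}) \<inter> path_image (\<gamma> {u, y}) = {u}"
    using meet[OF nF' F(1) F(3) ne'(1)] by (simp only:)
  have "{u, x} \<inter> {v, x} = {x}" using ne d by blast
  then show "path_image (\<gamma> {u, x}) \<inter> path_image (\<gamma> {v, x}) = {x}"
    using meet[OF nF' F(1) F(2) ne'(2)] by (simp only:)
  have "{u, x} \<inter> {v, y} = {}" using ne d by blast
  then show "path_image (\<gamma> {u, x}) \<inter> path_image (\<gamma> {v, y}) = {}"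
    using meet[OF nF' F(1) F(4) ne'(3)] by (simp only:)
qed

text \<open>The circle round \<open>u\<close> only has to leave out the other vertices, so that every edge at \<open>u\<close> reaches it. Two
  edges at \<open>u\<close> may cross inside the circle, and even hit it in the same point, but not if their other ends
  have a second common neighbour.\<close>
lemma rotations_have_no_common_triple:
  assumes G: "topological_graph V E \<gamma>" and nF: "\<not> (\<exists>F. self_crossing_four_cycle E \<gamma> F)"
  shows "\<exists>f. no_common_triple V (\<lambda>v. {w\<in>V. {v, w} \<in> E}) f"
proof -
  have "finite V" using G by (simp add: topological_graph_def simple_graph_def)
  then have "\<forall>u. \<exists>r>0. \<forall>w\<in>V. w \<noteq> u \<longrightarrow> r \<le> dist u w" using finite_set_avoid by blast
  from choice[OF this] obtain r where r: "\<And>u. r u > (0::real)" "\<And>u w. w \<in> V \<Longrightarrow> w \<noteq> u \<Longrightarrow> r u \<le> dist u w"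
    by blast
  define leaves where "leaves u w t \<longleftrightarrow> -pi < t \<and> t \<le> pi \<and>
      (\<exists>x\<in>{0..1}. spoke u (r u) (subpath 0 x (edge_from \<gamma> u w)) t)" for u w t
  define f where "f u w = (SOME t. leaves u w t)" for u w
  have f: "leaves u w (f u w)" if uw: "{u, w} \<in> E" for u w
  proof -
    have "{u, w} \<subseteq> V" "card {u, w} = 2" using G uw by (auto simp: topological_graph_def simple_graph_def)
    then have "w \<in> V" "w \<noteq> u" by auto
    then have "\<exists>t x. -pi < t \<and> t \<le> pi \<and> x \<in> {0..1} \<and> spoke u (r u) (subpath 0 x (edge_from \<gamma> u w)) t"
      using edge_from[OF G uw] r by (intro spoke_exists) auto
    then have "\<exists>t. leaves u w t" unfolding leaves_def by blast
    then show ?thesis unfolding f_def by (rule someI_ex)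
  qed
  have circle: "\<exists>z. z \<in> path_image (\<gamma> {u, w}) \<and> z = u + of_real (r u) * cis (f u w)" if uw: "{u, w} \<in> E" for u w
  proof -
    obtain x where x: "x \<in> {0..1}" "spoke u (r u) (subpath 0 x (edge_from \<gamma> u w)) (f u w)"
      using f[OF uw] by (auto simp: leaves_def)
    have "u + of_real (r u) * cis (f u w) \<in> path_image (subpath 0 x (edge_from \<gamma> u w))"
      by (rule spokeD(7)[OF x(2)])
    also have "\<dots> \<subseteq> path_image (edge_from \<gamma> u w)" using x(1) by (intro path_image_subpath_subset) auto
    finally show ?thesis using edge_from(4)[OF G uw] by simp
  qed
  have "no_common_triple V (\<lambda>v. {w\<in>V. {v, w} \<in> E}) f"
    unfolding no_common_triple_def
  proof (intro ballI impI conjI notI)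
    fix u v assume uv: "u \<in> V" "v \<in> V" "u \<noteq> v"
    let ?N = "{w\<in>V. {u, w} \<in> E} \<inter> {w\<in>V. {v, w} \<in> E}"
    \<comment> \<open>Equal angles would be a common point of two edges of a four-cycle.\<close>
    show "inj_on (f u) ?N"
    proof (rule inj_onI, rule ccontr)
      fix a b assume ab: "a \<in> ?N" "b \<in> ?N" "f u a = f u b" "a \<noteq> b"
      define z where "z = u + of_real (r u) * cis (f u a)"
      have "z \<in> path_image (\<gamma> {u, a})" "z \<in> path_image (\<gamma> {u, b})"
        using circle[of u a] circle[of u b] ab by (auto simp: z_def)
      moreover have "path_image (\<gamma> {u, a}) \<inter> path_image (\<gamma> {u, b}) = {u}"
        using common_neighbours_disjoint(1)[OF G nF, of u a v b] ab uv by simp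
      ultimately have "z = u" by blast
      then show False using r(1)[of u] by (simp add: z_def)
    qed
    fix a b c assume abc: "a \<in> ?N" "b \<in> ?N" "c \<in> ?N"
      and o: "f u a < f u b \<and> f u b < f u c \<and> f v a < f v b \<and> f v b < f v c"
    have ne: "a \<noteq> b" "a \<noteq> c" "b \<noteq> c" using o by auto
    have E: "{u, a} \<in> E" "{u, b} \<in> E" "{u, c} \<in> E" "{v, a} \<in> E" "{v, b} \<in> E" "{v, c} \<in> E" using abc by auto
    note D = common_neighbours_disjoint[OF G nF]
    note I = edge_from(4)[OF G E(1)] edge_from(4)[OF G E(2)] edge_from(4)[OF G E(3)]
       edge_from(4)[OF G E(4)] edge_from(4)[OF G E(5)] edge_from(4)[OF G E(6)]
    obtain xa xb xc where x: "xa \<in> {0..1}" "spoke u (r u) (subpath 0 xa (edge_from \<gamma> u a)) (f u a)"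
       "xb \<in> {0..1}" "spoke u (r u) (subpath 0 xb (edge_from \<gamma> u b)) (f u b)"
       "xc \<in> {0..1}" "spoke u (r u) (subpath 0 xc (edge_from \<gamma> u c)) (f u c)"
      using f[OF E(1)] f[OF E(2)] f[OF E(3)] unfolding leaves_def by blast
    obtain ya yb yc where y: "ya \<in> {0..1}" "spoke v (r v) (subpath 0 ya (edge_from \<gamma> v a)) (f v a)"
       "yb \<in> {0..1}" "spoke v (r v) (subpath 0 yb (edge_from \<gamma> v b)) (f v b)"
       "yc \<in> {0..1}" "spoke v (r v) (subpath 0 yc (edge_from \<gamma> v c)) (f v c)"
      using f[OF E(4)] f[OF E(5)] f[OF E(6)] unfolding leaves_def by blast
    have ang: "f u c < f u a + 2 * pi" "f v c < f v a + 2 * pi"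
      using f[OF E(1)] f[OF E(3)] f[OF E(4)] f[OF E(6)] unfolding leaves_def by linarith+
    show False
    proof (rule opposite_rotation[OF edge_from(1)[OF G E(1)] edge_from(1)[OF G E(2)] edge_from(1)[OF G E(3)]
         edge_from(1)[OF G E(4)] edge_from(1)[OF G E(5)] edge_from(1)[OF G E(6)]
         edge_from(2)[OF G E(1)] edge_from(2)[OF G E(2)] edge_from(2)[OF G E(3)]
         edge_from(2)[OF G E(4)] edge_from(2)[OF G E(5)] edge_from(2)[OF G E(6)]
         edge_from(3)[OF G E(1)] edge_from(3)[OF G E(4)] edge_from(3)[OF G E(2)]
         edge_from(3)[OF G E(5)] edge_from(3)[OF G E(3)] edge_from(3)[OF G E(6)] uv(3)
         _ _ _ _ _ _ _ _ _ _ _ _ _ _ r(1)[of u] r(1)[of v] x y])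
      show "path_image (edge_from \<gamma> u a) \<inter> path_image (edge_from \<gamma> u b) = {u}"
        unfolding I by (rule D(1)[OF E(1,4,2,5) uv(3) ne(1)])
      show "path_image (edge_from \<gamma> u a) \<inter> path_image (edge_from \<gamma> u c) = {u}"
        unfolding I by (rule D(1)[OF E(1,4,3,6) uv(3) ne(2)])
      show "path_image (edge_from \<gamma> u b) \<inter> path_image (edge_from \<gamma> u c) = {u}"
        unfolding I by (rule D(1)[OF E(2,5,3,6) uv(3) ne(3)])
      show "path_image (edge_from \<gamma> v a) \<inter> path_image (edge_from \<gamma> v b) = {v}"
        unfolding I by (rule D(1)[OF E(4,1,5,2) uv(3)[symmetric] ne(1)])
      show "path_image (edge_from \<gamma> v a) \<inter> path_image (edge_from \<gamma> v c) = {v}"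
        unfolding I by (rule D(1)[OF E(4,1,6,3) uv(3)[symmetric] ne(2)])
      show "path_image (edge_from \<gamma> v b) \<inter> path_image (edge_from \<gamma> v c) = {v}"
        unfolding I by (rule D(1)[OF E(5,2,6,3) uv(3)[symmetric] ne(3)])
      show "path_image (edge_from \<gamma> u a) \<inter> path_image (edge_from \<gamma> v a) = {a}"
        unfolding I by (rule D(2)[OF E(1,4,2,5) uv(3) ne(1)])
      show "path_image (edge_from \<gamma> u b) \<inter> path_image (edge_from \<gamma> v b) = {b}"
        unfolding I by (rule D(2)[OF E(2,5,3,6) uv(3) ne(3)])
      show "path_image (edge_from \<gamma> u a) \<inter> path_image (edge_from \<gamma> v b) = {}"
        unfolding I by (rule D(3)[OF E(1,4,2,5) uv(3) ne(1)])
      show "path_image (edge_from \<gamma> u a) \<inter> path_image (edge_from \<gamma> v c) = {}"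
        unfolding I by (rule D(3)[OF E(1,4,3,6) uv(3) ne(2)])
      show "path_image (edge_from \<gamma> u b) \<inter> path_image (edge_from \<gamma> v a) = {}"
        unfolding I by (rule D(3)[OF E(2,5,1,4) uv(3) ne(1)[symmetric]])
      show "path_image (edge_from \<gamma> u b) \<inter> path_image (edge_from \<gamma> v c) = {}"
        unfolding I by (rule D(3)[OF E(2,5,3,6) uv(3) ne(3)])
      show "path_image (edge_from \<gamma> u c) \<inter> path_image (edge_from \<gamma> v a) = {}"
        unfolding I by (rule D(3)[OF E(3,6,1,4) uv(3) ne(2)[symmetric]])
      show "path_image (edge_from \<gamma> u c) \<inter> path_image (edge_from \<gamma> v b) = {}"
        unfolding I by (rule D(3)[OF E(3,6,2,5) uv(3) ne(3)[symmetric]])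
    qed (use o ang in simp_all)
  qed
  then show ?thesis by blast
qed

theorem corollary1p8:
  shows "\<exists>C::real. C > 0 \<and>
    (\<forall>n::nat. n > 0 \<longrightarrow>
      (\<forall>V E \<gamma>. topological_graph V E \<gamma> \<and> card V = n \<and>
          \<not> (\<exists>F. self_crossing_four_cycle E \<gamma> F) \<longrightarrow>
        real (card E) \<le> C * real n powr (3 / 2)))"
proof (intro exI[of _ 12] conjI allI impI; (elim conjE)?)
  fix n :: nat and V :: "complex set" and E \<gamma>
  assume n: "0 < n" "card V = n" and G: "topological_graph V E \<gamma>" and nF: "\<not> (\<exists>F. self_crossing_four_cycle E \<gamma> F)"
  obtain f where f: "no_common_triple V (\<lambda>v. {w\<in>V. {v, w} \<in> E}) f"
    using rotations_have_no_common_triple[OF G nF] by blast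
  have V: "finite V" and E: "\<forall>e\<in>E. card e = 2" "\<forall>e\<in>E. e \<subseteq> V"
    using G by (auto simp: topological_graph_def simple_graph_def)
  have "{e\<in>E. e \<subseteq> V} = E" using E(2) by blast
  then have "real (card E) \<le> 12 * (real n * sqrt (real n))"
    using edges_le_of_no_common_triple[OF V E(1) f] n by simp
  also have "real n * sqrt (real n) = real n powr (3 / 2)"
  proof -
    have "real n powr (1 + 1 / 2) = real n powr 1 * real n powr (1 / 2)"
      by (rule powr_add)
    then show ?thesis by (simp add: powr_half_sqrt)
  qed
  finally show "real (card E) \<le> 12 * real n powr (3 / 2)" .
qed simp

end
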